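(* Let $\phi:\mathcal{L}\to\operatorname{End}V$ be a finite-dimensional irreducible representation of the multiloop algebra $\mathcal{L}$, let $I=I(\ker\phi)$, and let $a_1,\dots,a_r\in(F^\times)^N$ be the distinct points with $I\cap R_{\bar 0}=M_{a_1}\cap\cdots\cap M_{a_r}$. Choose $b_i=(b_{i1},\dots,b_{iN})\in(F^\times)^N$ with $b_{ij}^{m_j}=a_{ij}$ for all $i,j$. Then the evaluation map $$\psi_b:\mathcal{L}\to\mathfrak{g}^{\oplus r},\qquad x\otimes f\mapsto (f(b_1)x,\dots,f(b_r)x)$$ vanishes on $\ker\phi$, and the induced map $\bar\psi:\mathcal{L}/\ker\phi\to\mathfrak{g}\oplus\cdots\oplus\mathfrak{g}$ ($r$ copies) is a Lie algebra isomorphism.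
   Context: $F$ is an algebraically closed field of characteristic zero; $\mathfrak{g}$ is a finite-dimensional simple Lie algebra over $F$; $\sigma_1,\dots,\sigma_N$ are pairwise commuting automorphisms of $\mathfrak{g}$ of finite orders $m_1,\dots,m_N$; $\xi_i\in F$ is a fixed primitive $m_i$-th root of unity. $G=\mathbb{Z}/m_1\mathbb{Z}\times\cdots\times\mathbb{Z}/m_N\mathbb{Z}$, $\bar k$ is the image of $k\in\mathbb{Z}^N$, $\mathfrak{g}_{\bar k}=\{x\in\mathfrak{g}:\sigma_ix=\xi_i^{k_i}x\ \forall i\}$. $R=F[t_1^{\pm1},\dots,t_N^{\pm1}]$, $t^k=t_1^{k_1}\cdots t_N^{k_N}$, $R_{\bar 0}=F[t_1^{\pm m_1},\dots,t_N^{\pm m_N}]$, $R_{\bar k}=t^kR_{\bar 0}$. The multiloop algebra is $\mathcal{L}=\bigoplus_{\bar k\in G}\mathfrak{g}_{\bar k}\otimes R_{\bar k}\subseteq\mathfrak{g}\otimes R$ with pointwise bracket $[x\otimes f,y\otimes g]=[x,y]\otimes fg$. For each $\bar k$ fix a basis $\{x_{\bar kj}\}_j$ of $\mathfrak{g}_{\bar k}$ and let $\pi_{\bar kj}:\mathcal{L}\to R_{\bar k}$ be the coordinate projection onto $Fx_{\bar kj}\otimes R_{\bar k}$ followed by $x_{\bar kj}\otimes f\mapsto f$. For an ideal $\mathcal{I}$ of $\mathcal{L}$, $I(\mathcal{I})$ is the ideal of $R$ generated by $\bigcup_{\bar k,j}\pi_{\bar kj}(\mathcal{I})$. For $a\in(F^\times)^N$,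 $M_a=\langle t_1^{m_1}-a_1,\dots,t_N^{m_N}-a_N\rangle\subseteq R_{\bar 0}$. (It is known that for $\mathcal{I}=\ker\phi$, $I\cap R_{\bar 0}$ is a radical cofinite ideal of $R_{\bar 0}$, hence such distinct points $a_1,\dots,a_r$ exist and are unique.) *)

theory Defs
  imports "HOL-Analysis.Analysis" "HOL-Library.Function_Algebras" "HOL-Library.Poly_Mapping"
    "HOL-Computational_Algebra.Polynomial"
begin

definition alg_closed :: "'f::field itself \<Rightarrow> bool" where
  "alg_closed _ \<longleftrightarrow> (\<forall>p :: 'f poly. degree p > 0 \<longrightarrow> (\<exists>x. poly p x = 0))"

definition lie_algebra :: "('f::field \<Rightarrow> 'g::ab_group_add \<Rightarrow> 'g) \<Rightarrow> ('g \<Rightarrow> 'g \<Rightarrow> 'g) \<Rightarrow> bool" where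
  "lie_algebra sc br \<longleftrightarrow> vector_space sc
     \<and> (\<forall>x y z. br (x + y) z = br x z + br y z)
     \<and> (\<forall>x y z. br x (y + z) = br x y + br x z)
     \<and> (\<forall>c x y. br (sc c x) y = sc c (br x y))
     \<and> (\<forall>c x y. br x (sc c y) = sc c (br x y))
     \<and> (\<forall>x. br x x = 0)
     \<and> (\<forall>x y z. br x (br y z) + br y (br z x) + br z (br x y) = 0)"

definition fin_dim :: "('f::field \<Rightarrow> 'g::ab_group_add \<Rightarrow> 'g) \<Rightarrow> bool" where
  "fin_dim sc \<longleftrightarrow> (\<exists>B. finite B \<and> module.span sc B = UNIV)"

definition lie_ideal :: "('f::field \<Rightarrow> 'g::ab_group_add \<Rightarrow> 'g) \<Rightarrow> ('g \<Rightarrow> 'g \<Rightarrow> 'g) \<Rightarrow> 'g set \<Rightarrow> bool" where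
  "lie_ideal sc br J \<longleftrightarrow> module.subspace sc J \<and> (\<forall>x y. y \<in> J \<longrightarrow> br x y \<in> J)"

definition simple_lie_algebra :: "('f::field \<Rightarrow> 'g::ab_group_add \<Rightarrow> 'g) \<Rightarrow> ('g \<Rightarrow> 'g \<Rightarrow> 'g) \<Rightarrow> bool" where
  "simple_lie_algebra sc br \<longleftrightarrow> lie_algebra sc br
     \<and> (\<exists>x y. br x y \<noteq> 0)
     \<and> (\<forall>J. lie_ideal sc br J \<longrightarrow> J = {0} \<or> J = UNIV)"

definition lie_automorphism :: "('f::field \<Rightarrow> 'g::ab_group_add \<Rightarrow> 'g) \<Rightarrow> ('g \<Rightarrow> 'g \<Rightarrow> 'g) \<Rightarrow> ('g \<Rightarrow> 'g) \<Rightarrow> bool" where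
  "lie_automorphism sc br s \<longleftrightarrow> Vector_Spaces.linear sc sc s \<and> bij s \<and> (\<forall>x y. s (br x y) = br (s x) (s y))"

definition has_order :: "('g \<Rightarrow> 'g) \<Rightarrow> nat \<Rightarrow> bool" where
  "has_order s m \<longleftrightarrow> m > 0 \<and> (s ^^ m) = id \<and> (\<forall>k. 0 < k \<and> k < m \<longrightarrow> (s ^^ k) \<noteq> id)"

definition primitive_root :: "'f::field \<Rightarrow> nat \<Rightarrow> bool" where
  "primitive_root z m \<longleftrightarrow> m > 0 \<and> z ^ m = 1 \<and> (\<forall>k. 0 < k \<and> k < m \<longrightarrow> z ^ k \<noteq> 1)"

text \<open>Exponents k \<in> Z^N are functions 'n \<Rightarrow> int for a finite index type 'n (N = CARD('n)).
  An element  sum_k x_k \<otimes> t^k  of g \<otimes> R is represented by the finitely supported function k \<mapsto> x_k.\<close>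

definition grade_space :: "('f::field \<Rightarrow> 'g::ab_group_add \<Rightarrow> 'g) \<Rightarrow> ('n \<Rightarrow> 'g \<Rightarrow> 'g) \<Rightarrow> ('n \<Rightarrow> 'f) \<Rightarrow> ('n \<Rightarrow> int) \<Rightarrow> 'g set" where
  "grade_space sc \<sigma> \<xi> k = {y. \<forall>i. \<sigma> i y = sc (\<xi> i powi k i) y}"

definition multiloop :: "('f::field \<Rightarrow> 'g::ab_group_add \<Rightarrow> 'g) \<Rightarrow> ('n \<Rightarrow> 'g \<Rightarrow> 'g) \<Rightarrow> ('n \<Rightarrow> 'f) \<Rightarrow> (('n \<Rightarrow> int) \<Rightarrow> 'g) set" where
  "multiloop sc \<sigma> \<xi> = {x. finite {k. x k \<noteq> 0} \<and> (\<forall>k. x k \<in> grade_space sc \<sigma> \<xi> k)}"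

definition Ladd :: "(('n \<Rightarrow> int) \<Rightarrow> 'g::ab_group_add) \<Rightarrow> (('n \<Rightarrow> int) \<Rightarrow> 'g) \<Rightarrow> ('n \<Rightarrow> int) \<Rightarrow> 'g" where
  "Ladd x y = (\<lambda>k. x k + y k)"

definition Lscale :: "('f \<Rightarrow> 'g \<Rightarrow> 'g) \<Rightarrow> 'f \<Rightarrow> (('n \<Rightarrow> int) \<Rightarrow> 'g) \<Rightarrow> ('n \<Rightarrow> int) \<Rightarrow> 'g" where
  "Lscale sc c x = (\<lambda>k. sc c (x k))"

text \<open>[x \<otimes> t^j, y \<otimes> t^l] = [x,y] \<otimes> t^(j+l), extended bilinearly\<close>
definition Lbr :: "('g::ab_group_add \<Rightarrow> 'g \<Rightarrow> 'g) \<Rightarrow> (('n \<Rightarrow> int) \<Rightarrow> 'g) \<Rightarrow> (('n \<Rightarrow> int) \<Rightarrow> 'g) \<Rightarrow> ('n \<Rightarrow> int) \<Rightarrow> 'g" where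
  "Lbr br x y = (\<lambda>k. \<Sum>j\<in>{j. x j \<noteq> 0}. br (x j) (y (k - j)))"

definition representation_of :: "('f::field \<Rightarrow> 'g::ab_group_add \<Rightarrow> 'g) \<Rightarrow> ('g \<Rightarrow> 'g \<Rightarrow> 'g) \<Rightarrow> ('n \<Rightarrow> 'g \<Rightarrow> 'g) \<Rightarrow> ('n \<Rightarrow> 'f)
     \<Rightarrow> ('f \<Rightarrow> 'v::ab_group_add \<Rightarrow> 'v) \<Rightarrow> ((('n \<Rightarrow> int) \<Rightarrow> 'g) \<Rightarrow> 'v \<Rightarrow> 'v) \<Rightarrow> bool" where
  "representation_of sc br \<sigma> \<xi> scV \<phi> \<longleftrightarrow> vector_space scV
     \<and> (\<forall>x\<in>multiloop sc \<sigma> \<xi>. Vector_Spaces.linear scV scV (\<phi> x))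
     \<and> (\<forall>x\<in>multiloop sc \<sigma> \<xi>. \<forall>y\<in>multiloop sc \<sigma> \<xi>. \<forall>v. \<phi> (Ladd x y) v = \<phi> x v + \<phi> y v)
     \<and> (\<forall>x\<in>multiloop sc \<sigma> \<xi>. \<forall>c v. \<phi> (Lscale sc c x) v = scV c (\<phi> x v))
     \<and> (\<forall>x\<in>multiloop sc \<sigma> \<xi>. \<forall>y\<in>multiloop sc \<sigma> \<xi>. \<forall>v.
          \<phi> (Lbr br x y) v = \<phi> x (\<phi> y v) - \<phi> y (\<phi> x v))"

definition irreducible_rep :: "('f::field \<Rightarrow> 'g::ab_group_add \<Rightarrow> 'g) \<Rightarrow> ('n \<Rightarrow> 'g \<Rightarrow> 'g) \<Rightarrow> ('n \<Rightarrow> 'f)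
     \<Rightarrow> ('f \<Rightarrow> 'v::ab_group_add \<Rightarrow> 'v) \<Rightarrow> ((('n \<Rightarrow> int) \<Rightarrow> 'g) \<Rightarrow> 'v \<Rightarrow> 'v) \<Rightarrow> bool" where
  "irreducible_rep sc \<sigma> \<xi> scV \<phi> \<longleftrightarrow> (\<exists>v::'v. v \<noteq> 0)
     \<and> (\<forall>W. module.subspace scV W \<and> (\<forall>x\<in>multiloop sc \<sigma> \<xi>. \<forall>w\<in>W. \<phi> x w \<in> W)
            \<longrightarrow> W = {0} \<or> W = UNIV)"

definition rep_kernel :: "('f::field \<Rightarrow> 'g::ab_group_add \<Rightarrow> 'g) \<Rightarrow> ('n \<Rightarrow> 'g \<Rightarrow> 'g) \<Rightarrow> ('n \<Rightarrow> 'f)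
     \<Rightarrow> ((('n \<Rightarrow> int) \<Rightarrow> 'g) \<Rightarrow> 'v::zero \<Rightarrow> 'v) \<Rightarrow> (('n \<Rightarrow> int) \<Rightarrow> 'g) set" where
  "rep_kernel sc \<sigma> \<xi> \<phi> = {x \<in> multiloop sc \<sigma> \<xi>. \<forall>v. \<phi> x v = 0}"

section \<open>Laurent polynomials R = F[t_1^{\<pm>1},...,t_N^{\<pm>1}] as finitely supported maps Z^N \<rightarrow> F\<close>

text \<open>reduction of k modulo (m_1,...,m_N): canonical representative of \<bar>k \<in> G\<close>
definition red :: "('n \<Rightarrow> nat) \<Rightarrow> ('n \<Rightarrow> int) \<Rightarrow> 'n \<Rightarrow> int" where
  "red m k = (\<lambda>i. k i mod int (m i))"

definition Gset :: "('n \<Rightarrow> nat) \<Rightarrow> ('n \<Rightarrow> int) set" where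
  "Gset m = {c. \<forall>i. 0 \<le> c i \<and> c i < int (m i)}"

text \<open>pi_{c,e}: coordinate of x_k along basis vector e of the basis B c of g_c, collected as the
  Laurent polynomial sum_{k with red k = c} coeff * t^k \<in> R_c\<close>
definition coord_proj :: "('f::field \<Rightarrow> 'g::ab_group_add \<Rightarrow> 'g) \<Rightarrow> ('n \<Rightarrow> nat) \<Rightarrow> (('n \<Rightarrow> int) \<Rightarrow> 'g set)
     \<Rightarrow> ('n \<Rightarrow> int) \<Rightarrow> 'g \<Rightarrow> (('n \<Rightarrow> int) \<Rightarrow> 'g) \<Rightarrow> ('n \<Rightarrow> int) \<Rightarrow>\<^sub>0 'f" where
  "coord_proj sc m B c e x =
     (\<Sum>k\<in>{k. x k \<noteq> 0 \<and> red m k = c}. Poly_Mapping.single k (module.representation sc (B c) (x k) e))"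

definition ideal_I :: "('f::field \<Rightarrow> 'g::ab_group_add \<Rightarrow> 'g) \<Rightarrow> ('n \<Rightarrow> nat) \<Rightarrow> (('n \<Rightarrow> int) \<Rightarrow> 'g set)
     \<Rightarrow> (('n \<Rightarrow> int) \<Rightarrow> 'g) set \<Rightarrow> (('n \<Rightarrow> int) \<Rightarrow>\<^sub>0 'f) set" where
  "ideal_I sc m B J = module.span (*)
     {coord_proj sc m B c e x | c e x. c \<in> Gset m \<and> e \<in> B c \<and> x \<in> J}"

definition R0 :: "('n \<Rightarrow> nat) \<Rightarrow> (('n \<Rightarrow> int) \<Rightarrow>\<^sub>0 'f::field) set" where
  "R0 m = {f. \<forall>k\<in>Poly_Mapping.keys f. \<forall>i. int (m i) dvd k i}"

definition M_ideal :: "('n::finite \<Rightarrow> nat) \<Rightarrow> ('n \<Rightarrow> 'f::field) \<Rightarrow> (('n \<Rightarrow> int) \<Rightarrow>\<^sub>0 'f) set" where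
  "M_ideal m a = {f. \<exists>q. (\<forall>i. q i \<in> R0 m) \<and>
      f = (\<Sum>i\<in>UNIV. q i * (Poly_Mapping.single (\<lambda>j. if j = i then int (m i) else 0) 1
                               - Poly_Mapping.single 0 (a i)))}"

text \<open>x \<otimes> f \<mapsto> f(b) x, extended linearly\<close>
definition eval_at :: "('f::field \<Rightarrow> 'g::ab_group_add \<Rightarrow> 'g) \<Rightarrow> ('n::finite \<Rightarrow> 'f) \<Rightarrow> (('n \<Rightarrow> int) \<Rightarrow> 'g) \<Rightarrow> 'g" where
  "eval_at sc b x = (\<Sum>k\<in>{k. x k \<noteq> 0}. sc (\<Prod>i\<in>UNIV. b i powi k i) (x k))"

end

theory Submission
  imports Defs
begin

text \<open>
  The adjoint representation of the simple algebra \<open>g\<close> is irreducible with scalar commutant, so by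
  Jacobson density some operator in the algebra generated by \<open>ad g\<close> sends a chosen basis vector
  \<open>e\<close> to an arbitrary \<open>e'\<close> and kills all other basis vectors. Its homogeneous components lift to
  the multiloop algebra, with the total power of \<open>t\<close> prescribed freely within its class modulo
  \<open>m\<close>, and these lifts preserve every ideal \<open>K\<close>. Applied to \<open>x \<in> K\<close> they produce
  \<open>e' \<otimes> t\<^sup>l f\<close>, where \<open>f\<close> is the \<open>e\<close>-coordinate of \<open>x\<close>; hence \<open>K\<close> contains \<open>e' \<otimes> f\<close> for all
  \<open>f \<in> I(K)\<close> of the grade of \<open>e'\<close>, and membership in \<open>K\<close> can be tested on coordinates. Multiplying
  a coordinate by \<open>t\<^sup>-\<^sup>c\<close> moves it into \<open>R\<^sub>0\<close>, where membership in \<open>M\<^sub>a\<close> means vanishing at a point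
  \<open>b\<close> with \<open>b\<^sup>m = a\<close>. Therefore the kernel of the evaluation map is exactly \<open>ker \<phi>\<close>. Surjectivity is
  Lagrange interpolation in \<open>R\<^sub>0\<close> together with the decomposition of \<open>g\<close> into its grades.
\<close>

section \<open>Jacobson density for a simple Lie algebra\<close>

locale simple_lie = vector_space sc
  for sc :: "'f::field_char_0 \<Rightarrow> 'g::ab_group_add \<Rightarrow> 'g" (infixr "\<cdot>" 75) +
  fixes br :: "'g \<Rightarrow> 'g \<Rightarrow> 'g"
  assumes closed_field: "alg_closed TYPE('f)"
    and simple: "simple_lie_algebra sc br"
    and finite_dim: "fin_dim sc"
begin

lemma lie: "lie_algebra sc br"
  using simple by (simp add: simple_lie_algebra_def)

lemma br_add_left: "br (x + y) z = br x z + br y z"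
  and br_add_right: "br x (y + z) = br x y + br x z"
  and br_scale_left: "br (c \<cdot> x) y = c \<cdot> br x y"
  and br_scale_right: "br x (c \<cdot> y) = c \<cdot> br x y"
  using lie by (auto simp: lie_algebra_def)

lemma br_zero_left [simp]: "br 0 y = 0"
  using br_add_left[of 0 0 y] by simp

lemma br_zero_right [simp]: "br x 0 = 0"
  using br_add_right[of x 0 0] by simp

lemma br_sum_left: "br (\<Sum>i\<in>A. f i) y = (\<Sum>i\<in>A. br (f i) y)"
  by (induction A rule: infinite_finite_induct) (auto simp: br_add_left)

lemma br_sum_right: "br x (\<Sum>i\<in>A. f i) = (\<Sum>i\<in>A. br x (f i))"
  by (induction A rule: infinite_finite_induct) (auto simp: br_add_right)

lemma linear_iff:
  "Vector_Spaces.linear sc sc f \<longleftrightarrow> (\<forall>x y. f (x + y) = f x + f y) \<and> (\<forall>c x. f (c \<cdot> x) = c \<cdot> f x)"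
  by (simp add: Vector_Spaces.linear_iff vector_space_axioms)

lemma linear_br: "Vector_Spaces.linear sc sc (br y)"
  by unfold_locales (auto simp: br_add_right br_scale_right)

lemma lie_ideal_trivial: "lie_ideal sc br J \<Longrightarrow> J = {0} \<or> J = UNIV"
  using simple by (auto simp: simple_lie_algebra_def)

text \<open>The centre is an ideal, and it is proper because some bracket is nonzero.\<close>

lemma centre_trivial:
  assumes "\<And>y. br y v = 0"
  shows "v = 0"
proof -
  have "lie_ideal sc br {v. \<forall>y. br y v = 0}"
    by (auto simp: lie_ideal_def subspace_def br_add_right br_scale_right)
  moreover have "{v. \<forall>y. br y v = 0} \<noteq> UNIV"
    using simple by (auto simp: simple_lie_algebra_def)
  ultimately show ?thesis
    using lie_ideal_trivial assms by blast
qed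

section \<open>Polynomials in an operator, eigenvectors and Schur's lemma\<close>

lemma finite_dim_bound:
  obtains n where "\<And>S. independent S \<Longrightarrow> finite S \<and> card S \<le> n"
  using finite_dim independent_span_bound unfolding fin_dim_def by (metis subset_UNIV)

text \<open>This is the vector p(T) w, computed by Horner's scheme.\<close>

definition poly_op :: "('g \<Rightarrow> 'g) \<Rightarrow> 'g \<Rightarrow> 'f poly \<Rightarrow> 'g" where
  "poly_op T w p = fold_coeffs (\<lambda>a u. a \<cdot> w + T u) p 0"

context
  fixes T assumes linT: "Vector_Spaces.linear sc sc T"
begin

interpretation T: Vector_Spaces.linear sc sc T by (rule linT)

lemma poly_op_0 [simp]: "poly_op T w 0 = 0"
  by (simp add: poly_op_def)

lemma poly_op_pCons [simp]: "poly_op T w (pCons a p) = a \<cdot> w + T (poly_op T w p)"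
  by (cases "p = 0 \<and> a = 0") (auto simp: poly_op_def T.zero fold_coeffs_pCons_eq)

lemma poly_op_add: "poly_op T w (p + q) = poly_op T w p + poly_op T w q"
  by (induction p q rule: poly_induct2) (auto simp: T.add scale_left_distrib)

lemma poly_op_smult: "poly_op T w (smult c p) = c \<cdot> poly_op T w p"
  by (induction p) (auto simp: T.scale scale_right_distrib)

lemma poly_op_monom: "poly_op T w (monom c i) = c \<cdot> (T ^^ i) w"
  by (induction i) (auto simp: monom_Suc monom_0 T.scale T.zero)

lemma poly_op_sum: "poly_op T w (\<Sum>i\<in>A. f i) = (\<Sum>i\<in>A. poly_op T w (f i))"
  by (induction A rule: infinite_finite_induct) (auto simp: poly_op_add)

text \<open>Among the vectors T^i w with i \<le> n either two coincide, which gives X^i - X^j, or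
  they are n + 1 distinct vectors. As no independent set has more than n elements, a linear
  dependence then supplies the coefficients.\<close>

lemma annihilating_poly: "\<exists>p. p \<noteq> 0 \<and> poly_op T w p = 0"
proof -
  obtain n where n: "\<And>S. independent S \<Longrightarrow> finite S \<and> card S \<le> n"
    using finite_dim_bound by blast
  let ?f = "\<lambda>i. (T ^^ i) w"
  show ?thesis
  proof (cases "inj_on ?f {..n}")
    case True
    then have "card (?f ` {..n}) = Suc n"
      by (simp add: card_image)
    then have "dependent (?f ` {..n})"
      using n by (metis Suc_n_not_le_n)
    then obtain u where u: "\<exists>i\<in>{..n}. u (?f i) \<noteq> 0" "(\<Sum>v\<in>?f ` {..n}. u v \<cdot> v) = 0"
      by (subst (asm) dependent_finite) auto
    let ?p = "\<Sum>i\<le>n. monom (u (?f i)) i"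
    have "poly_op T w ?p = 0"
      using u(2) True by (simp add: poly_op_sum poly_op_monom sum.reindex)
    moreover have "coeff ?p i = u (?f i)" if "i \<le> n" for i
      using that by (simp add: coeff_sum)
    then have "?p \<noteq> 0"
      using u(1) by fastforce
    ultimately show ?thesis
      by blast
  next
    case False
    then obtain i j where ij: "i \<noteq> j" "?f i = ?f j"
      by (auto simp: inj_on_def)
    let ?p = "monom 1 i + monom (-1) j :: 'f poly"
    have "poly_op T w ?p = 0"
      unfolding poly_op_add poly_op_monom using ij(2) by simp
    moreover have "coeff ?p i \<noteq> 0"
      unfolding coeff_add coeff_monom using ij(1) by simp
    then have "?p \<noteq> 0"
      by fastforce
    ultimately show ?thesis
      by blast
  qed
qed

text \<open>A nonzero polynomial of least degree that kills some nonzero vector \<open>w\<close> is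
  not constant, so it factors as (X - c) q. Minimality makes q(T) w nonzero, and this vector is an
  eigenvector for \<open>c\<close>.\<close>

lemma eigenvector_exists: "\<exists>c w. w \<noteq> 0 \<and> T w = c \<cdot> w"
proof -
  obtain w0 :: 'g where w0: "w0 \<noteq> 0"
    using simple by (auto simp: simple_lie_algebra_def)
  let ?Q = "\<lambda>p. p \<noteq> 0 \<and> (\<exists>w. w \<noteq> 0 \<and> poly_op T w p = 0)"
  obtain p0 where "?Q p0"
    using annihilating_poly w0 by blast
  then obtain p where p: "?Q p" and min: "\<And>q. ?Q q \<Longrightarrow> degree p \<le> degree q"
    using ex_has_least_nat[of ?Q p0 degree] by blast
  then obtain w where w: "w \<noteq> 0" "poly_op T w p = 0"
    by blast
  have "degree p > 0"
  proof (rule ccontr)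
    assume "\<not> degree p > 0"
    then obtain a where a: "p = [:a:]"
      using degree_eq_zeroE by blast
    with p w show False
      by (simp add: T.zero)
  qed
  then obtain c where "poly p c = 0"
    using closed_field unfolding alg_closed_def by blast
  then obtain q where q: "p = [:- c, 1:] * q"
    using poly_eq_0_iff_dvd by (metis dvdE)
  with p have "q \<noteq> 0"
    by auto
  then have "degree p = Suc (degree q)"
    unfolding q by (subst degree_mult_eq) auto
  then have "poly_op T w q \<noteq> 0"
    using min[of q] \<open>q \<noteq> 0\<close> w(1) by auto
  moreover have "poly_op T w p = T (poly_op T w q) - c \<cdot> poly_op T w q"
  proof -
    have "p = smult (- c) q + pCons 0 q"
      by (simp add: q)
    then show ?thesis
      by (simp only: poly_op_add poly_op_smult poly_op_pCons) simp
  qed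
  ultimately show ?thesis
    using w(2) by (metis eq_iff_diff_eq_0)
qed

text \<open>An eigenspace of an operator that commutes with all \<open>br y\<close> is a nonzero
  ideal, hence everything by simplicity.\<close>

lemma schur:
  assumes comm: "\<And>y u. T (br y u) = br y (T u)"
  shows "\<exists>c. \<forall>u. T u = c \<cdot> u"
proof -
  obtain c w where cw: "w \<noteq> 0" "T w = c \<cdot> w"
    using eigenvector_exists by blast
  have "lie_ideal sc br {u. T u = c \<cdot> u}"
    by (auto simp: lie_ideal_def subspace_def T.zero T.add T.scale comm br_scale_right
        scale_right_distrib scale_left_commute)
  with cw show ?thesis
    using lie_ideal_trivial by blast
qed

end

text \<open>Jacobson density for an algebra of operators containing the adjoint representation. The
  induction extends \<open>S\<close> by one vector \<open>s\<close>: the assignment \<open>E s \<mapsto> E v\<close> on the annihilator of \<open>S\<close>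
  commutes with the adjoint representation, so Schur's lemma makes it a scalar.\<close>

lemma density:
  assumes lin: "\<And>E. E \<in> A \<Longrightarrow> Vector_Spaces.linear sc sc E"
    and add: "\<And>E E'. E \<in> A \<Longrightarrow> E' \<in> A \<Longrightarrow> (\<lambda>x. E x + E' x) \<in> A"
    and scale: "\<And>c E. E \<in> A \<Longrightarrow> (\<lambda>x. c \<cdot> E x) \<in> A"
    and comp: "\<And>y E. E \<in> A \<Longrightarrow> (\<lambda>x. br y (E x)) \<in> A"
    and ad: "\<And>y. br y \<in> A"
    and "finite S"
    and s: "s \<notin> span S"
  shows "\<exists>E\<in>A. (\<forall>t\<in>S. E t = 0) \<and> E s = w"
proof -
  define ann where "ann S = {E \<in> A. \<forall>t\<in>S. E t = 0}" for S
  have lin_ann: "E 0 = 0" "E (x + y) = E x + E y" "E (c \<cdot> x) = c \<cdot> E x" if "E \<in> ann S" for E x y c S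
  proof -
    interpret E: Vector_Spaces.linear sc sc E
      using that lin by (auto simp: ann_def)
    show "E 0 = 0" "E (x + y) = E x + E y" "E (c \<cdot> x) = c \<cdot> E x"
      by (auto simp: E.add E.scale E.zero)
  qed
  have ann_add: "(\<lambda>x. E x + E' x) \<in> ann S" if "E \<in> ann S" "E' \<in> ann S" for E E' S
    using that add by (auto simp: ann_def)
  have ann_scale: "(\<lambda>x. c \<cdot> E x) \<in> ann S" if "E \<in> ann S" for E c S
    using that scale by (auto simp: ann_def)
  have ann_comp: "(\<lambda>x. br y (E x)) \<in> ann S" if "E \<in> ann S" for E y S
    using that comp by (auto simp: ann_def)
  \<comment> \<open>The values at \<open>s\<close> of the operators killing \<open>S\<close> form an
    ideal, because these operators are closed under composition with \<open>br y\<close> on the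
    left. One nonzero value therefore yields all values.\<close>
  have onto: "\<exists>E\<in>ann S. E s = u" if E: "E \<in> ann S" "E s \<noteq> 0" for E s u S
  proof -
    have "lie_ideal sc br ((\<lambda>E. E s) ` ann S)"
      unfolding lie_ideal_def subspace_def
    proof (intro conjI allI ballI impI)
      show "0 \<in> (\<lambda>E. E s) ` ann S"
        by (rule image_eqI[OF _ ann_scale[OF E(1), of 0]]) simp
      show "x + y \<in> (\<lambda>E. E s) ` ann S" if x: "x \<in> (\<lambda>E. E s) ` ann S" and y: "y \<in> (\<lambda>E. E s) ` ann S" for x y
      proof -
        obtain E1 E2 where "E1 \<in> ann S" "x = E1 s" "E2 \<in> ann S" "y = E2 s"
          using x y by blast
        then show ?thesis
          by (intro image_eqI[OF _ ann_add[of E1 S E2]]) auto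
      qed
      show "c \<cdot> x \<in> (\<lambda>E. E s) ` ann S" if x: "x \<in> (\<lambda>E. E s) ` ann S" for x c
      proof -
        obtain E1 where "E1 \<in> ann S" "x = E1 s"
          using x by blast
        then show ?thesis
          by (intro image_eqI[OF _ ann_scale[of E1 S c]]) auto
      qed
      show "br y x \<in> (\<lambda>E. E s) ` ann S" if x: "x \<in> (\<lambda>E. E s) ` ann S" for x y
      proof -
        obtain E1 where "E1 \<in> ann S" "x = E1 s"
          using x by blast
        then show ?thesis
          by (intro image_eqI[OF _ ann_comp[of E1 S y]]) auto
      qed
    qed
    then have "(\<lambda>E. E s) ` ann S = UNIV"
      using lie_ideal_trivial E by blast
    then show ?thesis
      by (metis UNIV_I imageE)
  qed
  \<comment> \<open>Density in dual form: the common kernel of the annihilator of \<open>S\<close>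
    is no larger than the span of \<open>S\<close>. The vector stays arbitrary because the induction
    hypothesis is applied to \<open>v\<close>, to \<open>s\<close> and to a combination of
    both.\<close>
  have *: "v \<in> span S" if "\<And>E. E \<in> ann S \<Longrightarrow> E v = 0" for v
    using \<open>finite S\<close> that
  proof (induction S arbitrary: v)
    case empty
    then have "br y v = 0" for y
      using ad[of y] by (simp add: ann_def)
    then have "v = 0"
      by (rule centre_trivial)
    then show ?case
      by (simp add: span_zero)
  next
    case (insert s S)
    show ?case
    proof (cases "s \<in> span S")
      case True
      have "E s = 0" if "E \<in> ann S" for E
      proof -
        interpret E: Vector_Spaces.linear sc sc E
          using that lin by (auto simp: ann_def)
        show ?thesis
          by (rule E.eq_0_on_span[OF _ True]) (use that in \<open>auto simp: ann_def\<close>)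
      qed
      then have "ann S = ann (insert s S)"
        by (auto simp: ann_def)
      then have "v \<in> span S"
        using insert.IH[of v] insert.prems by simp
      then show ?thesis
        using span_mono[of S "insert s S"] by blast
    next
      case False
      then obtain E0 where E0: "E0 \<in> ann S" "E0 s \<noteq> 0"
        using insert.IH by blast
      \<comment> \<open>The choice of \<open>E\<close> is harmless: two operators in
        \<open>ann S\<close> with the same value at \<open>s\<close> differ by one that kills
        \<open>insert s S\<close>, and by the premise this difference also kills
        \<open>v\<close>.\<close>
      define \<theta> where "\<theta> u = (SOME E. E \<in> ann S \<and> E s = u) v" for u
      have \<theta>: "\<theta> (E s) = E v" if E: "E \<in> ann S" for E
      proof -
        define E' where "E' = (SOME E'. E' \<in> ann S \<and> E' s = E s)"
        have E': "E' \<in> ann S" "E' s = E s"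
          using someI[of "\<lambda>E'. E' \<in> ann S \<and> E' s = E s" E] E by (auto simp: E'_def)
        have "E s + (-1) \<cdot> E' s = 0"
          using E' by simp
        then have "(\<lambda>x. E x + (-1) \<cdot> E' x) \<in> ann (insert s S)"
          using ann_add[OF E ann_scale[OF E'(1), of "-1"]]
          unfolding ann_def by blast
        from insert.prems[OF this] show ?thesis
          by (simp add: \<theta>_def E'_def)
      qed
      have "Vector_Spaces.linear sc sc \<theta>"
      proof unfold_locales
        fix u u' c
        obtain E E' where "E \<in> ann S" "E s = u" "E' \<in> ann S" "E' s = u'"
          using onto[OF E0] by meson
        then show "\<theta> (u + u') = \<theta> u + \<theta> u'" "\<theta> (c \<cdot> u) = c \<cdot> \<theta> u"
          using \<theta> \<theta>[OF ann_add, of E E'] \<theta>[OF ann_scale, of E c] by auto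
      qed
      moreover have "\<theta> (br y u) = br y (\<theta> u)" for y u
      proof -
        obtain E where "E \<in> ann S" "E s = u"
          using onto[OF E0] by meson
        then show ?thesis
          using \<theta> \<theta>[OF ann_comp, of E y] by auto
      qed
      ultimately obtain c where c: "\<And>u. \<theta> u = c \<cdot> u"
        using schur by blast
      \<comment> \<open>Since E v = c E s for all \<open>E\<close> in \<open>ann S\<close>, the
        induction hypothesis applies to v - c s.\<close>
      have "E (v + (-c) \<cdot> s) = 0" if "E \<in> ann S" for E
        unfolding lin_ann(2,3)[OF that] using \<theta>[OF that] c by simp
      then have "v + (-c) \<cdot> s \<in> span S"
        using insert.IH by blast
      then show ?thesis
        by (auto simp: span_breakdown_eq)
    qed
  qed
  obtain E0 where "E0 \<in> ann S" "E0 s \<noteq> 0"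
    using *[of s] s by blast
  then obtain E where "E \<in> ann S" "E s = w"
    using onto[of E0 S s w] by blast
  then show ?thesis
    by (auto simp: ann_def)
qed

end

section \<open>The grading by commuting automorphisms\<close>

locale multiloop_setup = simple_lie sc br
  for sc :: "'f::field_char_0 \<Rightarrow> 'g::ab_group_add \<Rightarrow> 'g" (infixr "\<cdot>" 75)
    and br :: "'g \<Rightarrow> 'g \<Rightarrow> 'g" +
  fixes \<sigma> :: "'n::finite \<Rightarrow> 'g \<Rightarrow> 'g"
    and m :: "'n \<Rightarrow> nat"
    and \<xi> :: "'n \<Rightarrow> 'f"
  assumes aut: "\<And>i. lie_automorphism sc br (\<sigma> i)"
    and order: "\<And>i. has_order (\<sigma> i) (m i)"
    and comm: "\<And>i j. \<sigma> i \<circ> \<sigma> j = \<sigma> j \<circ> \<sigma> i"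
    and prim: "\<And>i. primitive_root (\<xi> i) (m i)"
begin

abbreviation gr :: "('n \<Rightarrow> int) \<Rightarrow> 'g set" where
  "gr \<equiv> grade_space sc \<sigma> \<xi>"

lemma m_pos [simp]: "0 < m i"
  using prim by (auto simp: primitive_root_def)

lemma xi_power_m: "\<xi> i ^ m i = 1"
  using prim by (auto simp: primitive_root_def)

lemma xi_nonzero [simp]: "\<xi> i \<noteq> 0"
proof
  assume "\<xi> i = 0"
  with xi_power_m[of i] have "m i = 0"
    by (simp add: power_0_left split: if_splits)
  then show False
    using m_pos[of i] by linarith
qed

lemma sigma_linear: "Vector_Spaces.linear sc sc (\<sigma> i)"
  using aut by (auto simp: lie_automorphism_def)

lemma sigma_add: "\<sigma> i (x + y) = \<sigma> i x + \<sigma> i y"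
  and sigma_scale: "\<sigma> i (c \<cdot> x) = c \<cdot> \<sigma> i x"
  and sigma_zero [simp]: "\<sigma> i 0 = 0"
  and sigma_sum: "\<sigma> i (sum f A) = (\<Sum>a\<in>A. \<sigma> i (f a))"
proof -
  interpret T: Vector_Spaces.linear sc sc "\<sigma> i"
    by (rule sigma_linear)
  show "\<sigma> i (x + y) = \<sigma> i x + \<sigma> i y" "\<sigma> i (c \<cdot> x) = c \<cdot> \<sigma> i x" "\<sigma> i 0 = 0"
    "\<sigma> i (sum f A) = (\<Sum>a\<in>A. \<sigma> i (f a))"
    by (auto simp: T.add T.scale T.zero T.sum)
qed

lemma sigma_br: "\<sigma> i (br x y) = br (\<sigma> i x) (\<sigma> i y)"
  using aut by (auto simp: lie_automorphism_def)

lemma sigma_commute: "\<sigma> i (\<sigma> j x) = \<sigma> j (\<sigma> i x)"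
  using comm by (metis comp_apply)

lemma sigma_funpow_m: "(\<sigma> i ^^ m i) x = x"
  using order by (auto simp: has_order_def)

lemma xi_powi_cong:
  assumes "k mod int (m i) = l mod int (m i)"
  shows "\<xi> i powi k = \<xi> i powi l"
proof -
  have "\<xi> i powi k = \<xi> i powi (k mod int (m i))" for k
  proof -
    have "\<xi> i powi k = \<xi> i powi (int (m i) * (k div int (m i)) + k mod int (m i))"
      by simp
    also have "\<dots> = \<xi> i powi (k mod int (m i))"
      by (simp only: power_int_add power_int_mult xi_nonzero simp_thms power_int_of_nat
          xi_power_m power_int_1_left mult_1_left)
    finally show ?thesis .
  qed
  then show ?thesis
    using assms by metis
qed

text \<open>The exponent difference is replaced by its least nonnegative residue
  \<open>n < m i\<close>, and primitivity forces \<open>n = 0\<close>.\<close>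

lemma xi_powi_inj:
  assumes "\<xi> i powi k = \<xi> i powi l"
  shows "k mod int (m i) = l mod int (m i)"
proof -
  define n where "n = nat ((k - l) mod int (m i))"
  have "\<xi> i powi (k - l) = 1"
    using assms by (simp add: power_int_diff)
  moreover have "\<xi> i powi (k - l) = \<xi> i powi int n"
    by (rule xi_powi_cong) (simp add: n_def)
  ultimately have "\<xi> i ^ n = 1"
    by simp
  moreover have "n < m i"
    by (simp add: n_def nat_less_iff)
  ultimately have "n = 0"
    using prim[of i] by (auto simp: primitive_root_def)
  then have "(k - l) mod int (m i) = 0"
    by (metis n_def m_pos of_nat_0_less_iff pos_mod_sign nat_0_iff antisym)
  then show ?thesis
    by (simp add: mod_eq_dvd_iff mod_0_imp_dvd)
qed

lemma gr_subspace: "subspace (gr k)"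
  by (auto simp: subspace_def grade_space_def sigma_add sigma_scale scale_right_distrib scale_left_commute)

lemma gr_zero [simp]: "0 \<in> gr k"
  and gr_add: "x \<in> gr k \<Longrightarrow> y \<in> gr k \<Longrightarrow> x + y \<in> gr k"
  and gr_scale: "x \<in> gr k \<Longrightarrow> c \<cdot> x \<in> gr k"
  using gr_subspace by (auto simp: subspace_def)

lemma gr_sum: "(\<And>i. i \<in> A \<Longrightarrow> f i \<in> gr k) \<Longrightarrow> sum f A \<in> gr k"
  using subspace_sum[OF gr_subspace] by blast

lemma gr_br: "x \<in> gr k \<Longrightarrow> y \<in> gr l \<Longrightarrow> br x y \<in> gr (k + l)"
  by (auto simp: grade_space_def sigma_br br_scale_left br_scale_right power_int_add plus_fun_def)

lemma red_eq_iff: "red m k = red m l \<longleftrightarrow> (\<forall>i. k i mod int (m i) = l i mod int (m i))"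
  by (auto simp: red_def fun_eq_iff)

lemma red_mem [simp]: "red m k \<in> Gset m"
  by (simp add: red_def Gset_def)

lemma red_idem [simp]: "c \<in> Gset m \<Longrightarrow> red m c = c"
  by (simp add: red_def Gset_def fun_eq_iff)

lemma gr_red_cong: "red m k = red m l \<Longrightarrow> gr k = gr l"
proof -
  assume "red m k = red m l"
  then have "\<xi> i powi k i = \<xi> i powi l i" for i
    by (intro xi_powi_cong) (simp add: red_eq_iff)
  then show ?thesis
    by (simp add: grade_space_def)
qed

lemma gr_red [simp]: "gr (red m k) = gr k"
  by (rule gr_red_cong) simp

lemma red_add_cong: "red m k = red m l \<Longrightarrow> red m (k + d) = red m (l + d)"
  unfolding red_eq_iff plus_fun_def by (blast intro: mod_add_cong)

lemma red_add_iff: "red m (k + d) = red m (l + d) \<longleftrightarrow> red m k = red m l"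
proof
  show "red m k = red m l" if "red m (k + d) = red m (l + d)"
    using red_add_cong[OF that, of "- d"] by (simp add: add.assoc)
qed (rule red_add_cong)

lemma finite_Gset [simp]: "finite (Gset m)"
proof -
  have "Gset m \<subseteq> PiE UNIV (\<lambda>i. {0..<int (m i)})"
    by (auto simp: Gset_def)
  then show ?thesis
    by (rule finite_subset) (auto intro: finite_PiE)
qed

text \<open>The components \<open>u n\<close> are the averages \<open>(1/m\<^sub>i) \<Sum>\<^sub>s \<xi>\<^sub>i\<^sup>-\<^sup>n\<^sup>s \<sigma>\<^sub>i\<^sup>s z\<close>.\<close>

lemma eigen_decomposition:
  "\<exists>u. z = (\<Sum>n<m i. u n) \<and> (\<forall>n. \<sigma> i (u n) = \<xi> i ^ n \<cdot> u n) \<and>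
       (\<forall>n j c. \<sigma> j z = c \<cdot> z \<longrightarrow> \<sigma> j (u n) = c \<cdot> u n)"
proof -
  define M where "M = m i"
  define x where "x = \<xi> i"
  have x: "x \<noteq> 0" "x ^ M = 1"
    by (simp_all add: x_def M_def xi_power_m)
  have M: "M > 0"
    by (simp add: M_def)
  define w where "w n s = inverse (x ^ (n * s)) \<cdot> (\<sigma> i ^^ s) z" for n s
  define u where "u n = inverse (of_nat M) \<cdot> (\<Sum>s<M. w n s)" for n
  have w_shift: "\<sigma> i (w n s) = x ^ n \<cdot> w n (Suc s)" for n s
    using x by (simp add: w_def sigma_scale power_add field_simps)
  have w_period: "w n M = w n 0" for n
  proof -
    have "x ^ (n * M) = 1"
      by (metis mult.commute power_mult power_one x(2))
    then show ?thesis
      by (simp add: w_def M_def sigma_funpow_m)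
  qed
  \<comment> \<open>Shifting the summation index over a full period changes nothing; this is why
    \<open>u n\<close> is an eigenvector.\<close>
  have sh: "(\<Sum>s<M. w n (Suc s)) = (\<Sum>s<M. w n s)" for n
    using sum.lessThan_Suc_shift[of "w n" M] w_period[of n] by simp
  have "\<sigma> i (u n) = x ^ n \<cdot> u n" for n
    by (simp add: u_def sigma_scale sigma_sum w_shift flip: scale_sum_right)
      (simp add: sh scale_left_commute mult.commute)
  \<comment> \<open>The automorphisms commute, so each average inherits the eigenvalues that
    \<open>z\<close> already has.\<close>
  moreover have "\<sigma> j (u n) = c \<cdot> u n" if j: "\<sigma> j z = c \<cdot> z" for n j c
  proof -
    have "\<sigma> j ((\<sigma> i ^^ s) z) = c \<cdot> (\<sigma> i ^^ s) z" for s
      by (induction s) (auto simp: j sigma_commute[of j i] sigma_scale)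
    then show ?thesis
      by (simp add: u_def w_def sigma_scale sigma_sum scale_sum_right mult_ac)
  qed
  moreover have "z = (\<Sum>n<M. u n)"
  proof -
    \<comment> \<open>For 0 < s < M the summands are the powers of an M-th root of unity other than
      1, so their geometric sum vanishes. After the sums are swapped only s = 0 survives, which is
      \<open>z\<close> itself.\<close>
    have orth: "(\<Sum>n<M. inverse (x ^ (n * s))) = (if s = 0 then of_nat M else 0)" if "s < M" for s
    proof (cases "s = 0")
      case False
      have "x ^ s \<noteq> 1"
        using prim[of i] that False by (auto simp: primitive_root_def x_def M_def)
      then have "inverse (x ^ s) \<noteq> 1"
        by (metis inverse_inverse_eq inverse_1)
      moreover have "inverse (x ^ s) ^ M = 1"
        by (metis inverse_1 mult.commute power_inverse power_mult power_one x(2))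
      ultimately have "(\<Sum>n<M. inverse (x ^ s) ^ n) = 0"
        by (simp add: geometric_sum)
      then show ?thesis
        using False by (simp add: power_mult mult.commute[of _ s] power_inverse)
    qed auto
    have "(\<Sum>n<M. u n) = inverse (of_nat M) \<cdot> (\<Sum>n<M. \<Sum>s<M. w n s)"
      by (simp add: u_def scale_sum_right)
    also have "(\<Sum>n<M. \<Sum>s<M. w n s) = (\<Sum>s<M. \<Sum>n<M. w n s)"
      by (rule sum.swap)
    also have "\<dots> = (\<Sum>s<M. (\<Sum>n<M. inverse (x ^ (n * s))) \<cdot> (\<sigma> i ^^ s) z)"
      by (simp add: w_def scale_sum_left)
    also have "\<dots> = (\<Sum>s<M. if s = 0 then of_nat M \<cdot> z else 0)"
      by (intro sum.cong refl) (auto simp: orth)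
    also have "\<dots> = of_nat M \<cdot> z"
      using M by simp
    finally show ?thesis
      using M by simp
  qed
  ultimately show ?thesis
    unfolding M_def x_def by (intro exI[of _ u]) blast
qed

text \<open>The automorphisms are diagonalised one after another: a joint eigenvector for those in
  \<open>I\<close> splits into eigenvectors of one more \<open>\<sigma> i\<close>, and the last
  clause of \<open>eigen_decomposition\<close> keeps the eigenvalues obtained so far.\<close>

lemma span_gr: "y \<in> span (\<Union>c\<in>Gset m. gr c)"
proof -
  have "y \<in> span (\<Union>c\<in>Gset m. {z. \<forall>i\<in>I. \<sigma> i z = (\<xi> i powi c i) \<cdot> z})" if "finite I" for I
    using that
  proof (induction I)
    case empty
    have "Gset m \<noteq> {}"
      using red_mem by blast
    then show ?case
      by (intro span_base) auto
  next
    case (insert i I)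
    let ?U = "\<lambda>I. \<Union>c\<in>Gset m. {z. \<forall>i\<in>I. \<sigma> i z = (\<xi> i powi c i) \<cdot> z}"
    have "?U I \<subseteq> span (?U (insert i I))"
    proof
      fix z assume "z \<in> ?U I"
      then obtain c where c: "c \<in> Gset m" "\<And>j. j \<in> I \<Longrightarrow> \<sigma> j z = (\<xi> j powi c j) \<cdot> z"
        by blast
      obtain u where u: "z = (\<Sum>n<m i. u n)" "\<And>n. \<sigma> i (u n) = \<xi> i ^ n \<cdot> u n"
        "\<And>n j c. \<sigma> j z = c \<cdot> z \<Longrightarrow> \<sigma> j (u n) = c \<cdot> u n"
        using eigen_decomposition[of z i] by blast
      have "u n \<in> ?U (insert i I)" if "n < m i" for n
      proof -
        have "c(i := int n) \<in> Gset m"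
          using c(1) that by (auto simp: Gset_def)
        moreover have "\<forall>j\<in>insert i I. \<sigma> j (u n) = (\<xi> j powi (c(i := int n)) j) \<cdot> u n"
          using u(2,3) c(2) by auto
        ultimately show ?thesis
          by blast
      qed
      then show "z \<in> span (?U (insert i I))"
        unfolding u(1) by (intro span_sum span_base) auto
    qed
    then show ?case
      using insert.IH span_minimal[OF _ subspace_span] by blast
  qed
  from this[of UNIV] show ?thesis
    by (simp add: grade_space_def)
qed

section \<open>Decomposition into grades and the projections onto them\<close>

lemma gr_decomposition: "\<exists>u. (\<forall>c\<in>Gset m. u c \<in> gr c) \<and> y = (\<Sum>c\<in>Gset m. u c)"
  using span_gr[of y]
proof (induction rule: span_induct_alt)
  case base
  show ?case
    by (intro exI[of _ "\<lambda>_. 0"]) auto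
next
  case (step a x y)
  then obtain c u where c: "c \<in> Gset m" "x \<in> gr c" and
    u: "\<And>c. c \<in> Gset m \<Longrightarrow> u c \<in> gr c" "y = (\<Sum>c\<in>Gset m. u c)"
    by blast
  have "a \<cdot> x + y = (\<Sum>d\<in>Gset m. (if d = c then a \<cdot> x else 0) + u d)"
    using c(1) by (simp add: sum.distrib u(2))
  moreover have "\<forall>d\<in>Gset m. (if d = c then a \<cdot> x else 0) + u d \<in> gr d"
    using c u(1) by (auto intro: gr_add gr_scale)
  ultimately show ?case
    by (intro exI[of _ "\<lambda>d. (if d = c then a \<cdot> x else 0) + u d"]) blast
qed

text \<open>The usual argument for eigenvectors: applying \<sigma>_i - \<xi>_i^(d_i) to the relation
  removes the term of \<open>d\<close> and multiplies every other term by a scalar, to which the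
  induction hypothesis applies.\<close>

lemma gr_independent:
  assumes "finite S" "S \<subseteq> Gset m" "\<And>c. c \<in> S \<Longrightarrow> u c \<in> gr c" "(\<Sum>c\<in>S. u c) = 0" "c \<in> S"
  shows "u c = 0"
  using assms
proof (induction S arbitrary: u c)
  case (insert d S)
  have zero: "u e = 0" if "e \<in> S" for e
  proof -
    have "e \<noteq> d" "e \<in> Gset m" "d \<in> Gset m"
      using that insert.hyps insert.prems(1) by auto
    then have "red m e \<noteq> red m d"
      by simp
    then obtain i where "e i mod int (m i) \<noteq> d i mod int (m i)"
      unfolding red_eq_iff by blast
    \<comment> \<open>The index \<open>i\<close> depends on \<open>e\<close>; only the scalar at
      \<open>e\<close> has to be nonzero.\<close>
    then have ne: "\<xi> i powi e i - \<xi> i powi d i \<noteq> 0"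
      using xi_powi_inj[of i "e i" "d i"] by auto
    let ?v = "\<lambda>c. (\<xi> i powi c i - \<xi> i powi d i) \<cdot> u c"
    have v: "?v c = \<sigma> i (u c) - (\<xi> i powi d i) \<cdot> u c" if "c \<in> insert d S" for c
      using insert.prems(2)[OF that] by (simp add: grade_space_def scale_left_diff_distrib)
    have "(\<Sum>c\<in>insert d S. ?v c) = \<sigma> i (\<Sum>c\<in>insert d S. u c) - (\<xi> i powi d i) \<cdot> (\<Sum>c\<in>insert d S. u c)"
      by (subst sum.cong[OF refl v]) (simp_all add: sum_subtractf sigma_sum scale_sum_right)
    then have "(\<Sum>c\<in>S. ?v c) = 0"
      using insert by simp
    then have "?v e = 0"
      using insert.IH[of ?v e] insert.prems that by (auto intro: gr_scale)
    with ne show ?thesis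
      by simp
  qed
  then have "(\<Sum>c\<in>S. u c) = 0"
    by simp
  then have "u d = 0"
    using insert by simp
  with zero insert.prems show ?case
    by auto
qed auto

text \<open>Reading the component at \<open>red m k\<close> makes \<open>proj\<close> available for
  every exponent, not only for representatives of G. The chosen family is unique on
  \<open>Gset m\<close> by \<open>gr_independent\<close>.\<close>

definition proj :: "('n \<Rightarrow> int) \<Rightarrow> 'g \<Rightarrow> 'g" where
  "proj k y = (SOME u. (\<forall>c\<in>Gset m. u c \<in> gr c) \<and> y = (\<Sum>c\<in>Gset m. u c)) (red m k)"

lemma proj_mem_Gset: "c \<in> Gset m \<Longrightarrow> proj c y \<in> gr c"
  and sum_proj: "(\<Sum>c\<in>Gset m. proj c y) = y"
proof -
  define u where "u = (SOME u. (\<forall>c\<in>Gset m. u c \<in> gr c) \<and> y = (\<Sum>c\<in>Gset m. u c))"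
  have u: "(\<forall>c\<in>Gset m. u c \<in> gr c) \<and> y = (\<Sum>c\<in>Gset m. u c)"
    unfolding u_def by (rule someI_ex[OF gr_decomposition])
  have p: "proj c y = u c" if "c \<in> Gset m" for c
    using that by (simp add: proj_def u_def)
  show "c \<in> Gset m \<Longrightarrow> proj c y \<in> gr c" "(\<Sum>c\<in>Gset m. proj c y) = y"
    using u p by (simp, metis (no_types, lifting) sum.cong)
qed

lemma proj_cong: "red m k = red m l \<Longrightarrow> proj k y = proj l y"
  unfolding proj_def by simp

lemma proj_red [simp]: "proj (red m k) y = proj k y"
  by (rule proj_cong) simp

lemma proj_mem [simp]: "proj k y \<in> gr k"
  using proj_mem_Gset[of "red m k" y] by simp

lemma proj_unique:
  assumes "\<And>c. c \<in> Gset m \<Longrightarrow> u c \<in> gr c" "c \<in> Gset m"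
  shows "proj c (\<Sum>c\<in>Gset m. u c) = u c"
proof -
  let ?y = "\<Sum>c\<in>Gset m. u c"
  have "proj c ?y + (-1) \<cdot> u c = 0"
  proof (rule gr_independent[where S = "Gset m" and u = "\<lambda>c. proj c ?y + (-1) \<cdot> u c"])
    show "(\<Sum>c\<in>Gset m. proj c ?y + (-1) \<cdot> u c) = 0"
      by (simp add: sum_negf sum_proj sum_subtractf)
    show "proj c ?y + (-1) \<cdot> u c \<in> gr c" if "c \<in> Gset m" for c
      using assms(1)[OF that] by (intro gr_add gr_scale) auto
  qed (use assms in auto)
  then show ?thesis
    by simp
qed

lemma proj_add: "proj k (x + y) = proj k x + proj k y"
  using proj_unique[of "\<lambda>c. proj c x + proj c y" "red m k"]
  by (simp add: sum.distrib sum_proj gr_add)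

lemma proj_scale: "proj k (a \<cdot> x) = a \<cdot> proj k x"
proof -
  have "proj (red m k) (\<Sum>c\<in>Gset m. a \<cdot> proj c x) = a \<cdot> proj (red m k) x"
    by (rule proj_unique) (simp_all add: gr_scale)
  moreover have "(\<Sum>c\<in>Gset m. a \<cdot> proj c x) = a \<cdot> x"
    by (metis scale_sum_right sum_proj)
  ultimately show ?thesis
    by simp
qed

lemma proj_gr:
  assumes "x \<in> gr l"
  shows "proj k x = (if red m k = red m l then x else 0)"
proof -
  have "(\<Sum>c\<in>Gset m. if c = red m l then x else 0) = x"
    by (subst sum.delta) simp_all
  moreover have "proj (red m k) (\<Sum>c\<in>Gset m. if c = red m l then x else 0) =
      (if red m k = red m l then x else 0)"
    by (rule proj_unique) (use assms in \<open>simp_all split: if_split\<close>)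
  ultimately show ?thesis
    by simp
qed

lemma proj_zero [simp]: "proj k 0 = 0"
  using proj_gr[of 0 k k] by simp

lemma proj_sum: "proj k (sum f A) = (\<Sum>a\<in>A. proj k (f a))"
  by (induction A rule: infinite_finite_induct) (auto simp: proj_add)

text \<open>Bracketing with \<open>y\<close> shifts every grade by \<open>d\<close>, so only the
  component of \<open>z\<close> in the class of k - d reaches the class of \<open>k\<close>.\<close>

lemma proj_br:
  assumes "y \<in> gr d"
  shows "proj k (br y z) = br y (proj (k - d) z)"
proof -
  have "proj k (br y (proj c z)) = (if red m (k - d) = c then br y (proj c z) else 0)"
    if "c \<in> Gset m" for c
  proof -
    have "red m k = red m (d + c) \<longleftrightarrow> red m (k - d) = red m c"
      using red_add_iff[of "k - d" d c] by (simp add: add.commute)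
    then show ?thesis
      using proj_gr[OF gr_br[OF assms proj_mem], of k c z] that by simp
  qed
  then have "proj k (br y (\<Sum>c\<in>Gset m. proj c z)) = br y (proj (red m (k - d)) z)"
    by (simp add: br_sum_right proj_sum del: proj_red)
  then show ?thesis
    by (simp add: sum_proj)
qed

end

section \<open>Laurent polynomials and their evaluation\<close>

lemma sum_apply: "(\<Sum>i\<in>A. f i) j = (\<Sum>i\<in>A. f i j :: 'b::comm_monoid_add)"
  by (induction A rule: infinite_finite_induct) auto

abbreviation tpow :: "('n::finite \<Rightarrow> 'f::field) \<Rightarrow> ('n \<Rightarrow> int) \<Rightarrow> 'f" where
  "tpow b k \<equiv> \<Prod>i\<in>UNIV. b i powi k i"

definition laurent_eval :: "('n::finite \<Rightarrow> 'f::field) \<Rightarrow> (('n \<Rightarrow> int) \<Rightarrow>\<^sub>0 'f) \<Rightarrow> 'f" where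
  "laurent_eval b p = (\<Sum>k\<in>Poly_Mapping.keys p. Poly_Mapping.lookup p k * tpow b k)"

lemma tpow_add:
  fixes b :: "'n::finite \<Rightarrow> 'f::field"
  assumes "\<And>i. b i \<noteq> 0"
  shows "tpow b (k + l) = tpow b k * tpow b l"
  using assms by (simp add: power_int_add prod.distrib)

lemma tpow_nonzero:
  fixes b :: "'n::finite \<Rightarrow> 'f::field"
  assumes "\<And>i. b i \<noteq> 0"
  shows "tpow b k \<noteq> 0"
  using assms by simp

lemma laurent_eval_superset:
  assumes "finite A" "Poly_Mapping.keys p \<subseteq> A"
  shows "laurent_eval b p = (\<Sum>k\<in>A. Poly_Mapping.lookup p k * tpow b k)"
  unfolding laurent_eval_def using assms
  by (intro sum.mono_neutral_left) (auto simp: in_keys_iff)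

lemma laurent_eval_add: "laurent_eval b (p + q) = laurent_eval b p + laurent_eval b q"
proof -
  let ?A = "Poly_Mapping.keys p \<union> Poly_Mapping.keys q"
  have "laurent_eval b (p + q) = (\<Sum>k\<in>?A. Poly_Mapping.lookup (p + q) k * tpow b k)"
    using Poly_Mapping.keys_add[of p q] by (intro laurent_eval_superset) auto
  moreover have "laurent_eval b p = (\<Sum>k\<in>?A. Poly_Mapping.lookup p k * tpow b k)"
    "laurent_eval b q = (\<Sum>k\<in>?A. Poly_Mapping.lookup q k * tpow b k)"
    by (rule laurent_eval_superset; auto)+
  ultimately show ?thesis
    by (simp add: lookup_add distrib_right sum.distrib)
qed

lemma laurent_eval_zero [simp]: "laurent_eval b 0 = 0"
  by (simp add: laurent_eval_def)

lemma laurent_eval_single [simp]: "laurent_eval b (Poly_Mapping.single k c) = c * tpow b k"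
  by (subst laurent_eval_superset[of "{k}"]) auto

lemma laurent_eval_uminus: "laurent_eval b (- p) = - laurent_eval b p"
  using laurent_eval_add[of b p "- p"] by (simp add: eq_neg_iff_add_eq_0 add.commute)

lemma laurent_eval_diff: "laurent_eval b (p - q) = laurent_eval b p - laurent_eval b q"
  using laurent_eval_add[of b p "- q"] by (simp add: laurent_eval_uminus)

lemma laurent_eval_sum: "laurent_eval b (\<Sum>i\<in>A. f i) = (\<Sum>i\<in>A. laurent_eval b (f i))"
  by (induction A rule: infinite_finite_induct) (auto simp: laurent_eval_add)

lemma laurent_sum_single:
  "p = (\<Sum>k\<in>Poly_Mapping.keys p. Poly_Mapping.single k (Poly_Mapping.lookup p k))"
  by (rule poly_mapping_eqI) (simp add: lookup_sum lookup_single when_def in_keys_iff)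

text \<open>Monomials are added one at a time with no condition on \<open>k\<close>, so an additive
  property only has to be checked on monomials.\<close>

lemma laurent_induct [case_names zero single_add]:
  fixes p :: "('n \<Rightarrow> int) \<Rightarrow>\<^sub>0 'f::field"
  assumes "P 0" "\<And>k c p. P p \<Longrightarrow> P (Poly_Mapping.single k c + p)"
  shows "P p"
proof -
  have "P (\<Sum>k\<in>A. Poly_Mapping.single k (Poly_Mapping.lookup p k))" if "finite A" for A
    using that by (induction A) (auto intro: assms)
  then show ?thesis
    by (subst laurent_sum_single) auto
qed

lemma laurent_eval_mult:
  assumes "\<And>i. b i \<noteq> 0"
  shows "laurent_eval b (p * q) = laurent_eval b p * laurent_eval b q"
proof (induction p rule: laurent_induct)
  case (single_add k c p)
  have "laurent_eval b (Poly_Mapping.single k c * q) = c * tpow b k * laurent_eval b q"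
  proof (induction q rule: laurent_induct)
    case (single_add l d q)
    then show ?case
      by (simp add: distrib_left laurent_eval_add mult_single tpow_add[OF assms, unfolded plus_fun_def] plus_fun_def)
  qed auto
  then show ?case
    using single_add by (simp add: distrib_right laurent_eval_add)
qed auto

lemma laurent_eval_one [simp]: "laurent_eval b 1 = 1"
proof -
  have "laurent_eval b (Poly_Mapping.single 0 1) = 1"
    unfolding laurent_eval_single by simp
  then show ?thesis
    by simp
qed

lemma laurent_eval_prod:
  assumes "\<And>i. b i \<noteq> 0"
  shows "laurent_eval b (\<Prod>i\<in>A. f i) = (\<Prod>i\<in>A. laurent_eval b (f i))"
  by (induction A rule: infinite_finite_induct) (auto simp: laurent_eval_mult[OF assms])

lemma lookup_single_mult:
  fixes f :: "('n \<Rightarrow> int) \<Rightarrow>\<^sub>0 'f::field"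
  shows "Poly_Mapping.lookup (Poly_Mapping.single l c * f) k = c * Poly_Mapping.lookup f (k - l)"
proof -
  have "Poly_Mapping.lookup (Poly_Mapping.single l c * f) (l + i) = c * Poly_Mapping.lookup f i" for i
  proof (induction f rule: laurent_induct)
    case (single_add j d f)
    then show ?case
      by (simp add: distrib_left lookup_add mult_single lookup_single when_def del: plus_fun_apply)
  qed auto
  from this[of "k - l"] show ?thesis
    by (simp only: add.commute[of l] diff_add_cancel)
qed

section \<open>The subring R_0 and its ideals M_a\<close>

lemma R0_zero [simp]: "0 \<in> R0 m"
  and R0_one [simp]: "1 \<in> R0 m"
  by (auto simp: R0_def)

lemma R0_const [simp]: "Poly_Mapping.single 0 c \<in> R0 m"
  by (simp add: R0_def)

lemma R0_add: "p \<in> R0 m \<Longrightarrow> q \<in> R0 m \<Longrightarrow> p + q \<in> R0 m"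
  using Poly_Mapping.keys_add[of p q] by (auto simp: R0_def)

lemma R0_single: "(\<And>i. int (m i) dvd k i) \<Longrightarrow> Poly_Mapping.single k c \<in> R0 m"
  by (simp add: R0_def)

lemma R0_mult: "p \<in> R0 m \<Longrightarrow> q \<in> R0 m \<Longrightarrow> p * q \<in> R0 m"
  using keys_mult[of p q] by (fastforce simp: R0_def)

lemma R0_uminus: "p \<in> R0 m \<Longrightarrow> - p \<in> R0 m"
  using R0_mult[OF R0_const[of "-1"]] by (simp add: single_uminus)

lemma R0_diff: "p \<in> R0 m \<Longrightarrow> q \<in> R0 m \<Longrightarrow> p - q \<in> R0 m"
  using R0_add[OF _ R0_uminus] by fastforce

lemma R0_prod: "(\<And>i. i \<in> A \<Longrightarrow> f i \<in> R0 m) \<Longrightarrow> (\<Prod>i\<in>A. f i) \<in> R0 m"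
  by (induction A rule: infinite_finite_induct) (auto intro: R0_mult)

text \<open>The generator t_i^(m_i) - a_i of M_a.\<close>

definition M_gen :: "('n::finite \<Rightarrow> nat) \<Rightarrow> ('n \<Rightarrow> 'f::field) \<Rightarrow> 'n \<Rightarrow> ('n \<Rightarrow> int) \<Rightarrow>\<^sub>0 'f" where
  "M_gen m a i = Poly_Mapping.single (\<lambda>j. if j = i then int (m i) else 0) 1 - Poly_Mapping.single 0 (a i)"

lemma M_gen_R0: "M_gen m a i \<in> R0 m"
  unfolding M_gen_def by (intro R0_diff R0_single R0_const) auto

lemma laurent_eval_M_gen: "laurent_eval b (M_gen m a i) = b i ^ m i - a i"
proof -
  have "tpow b (\<lambda>j. if j = i then int (m i) else 0) = (\<Prod>j\<in>UNIV. if j = i then b i ^ m i else 1)"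
    by (intro prod.cong) auto
  then show ?thesis
    by (simp add: M_gen_def laurent_eval_diff)
qed

lemma M_ideal_iff: "f \<in> M_ideal m a \<longleftrightarrow> (\<exists>q. (\<forall>i. q i \<in> R0 m) \<and> f = (\<Sum>i\<in>UNIV. q i * M_gen m a i))"
  by (simp add: M_ideal_def M_gen_def)

lemma M_ideal_zero [simp]: "0 \<in> M_ideal m a"
  unfolding M_ideal_iff by (intro exI[of _ "\<lambda>_. 0"]) auto

lemma M_ideal_add: "f \<in> M_ideal m a \<Longrightarrow> g \<in> M_ideal m a \<Longrightarrow> f + g \<in> M_ideal m a"
  unfolding M_ideal_iff
proof (elim exE conjE)
  fix p q
  assume "\<forall>i. q i \<in> R0 m" "\<forall>i. p i \<in> R0 m"
    "f = (\<Sum>i\<in>UNIV. p i * M_gen m a i)" "g = (\<Sum>i\<in>UNIV. q i * M_gen m a i)"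
  then show "\<exists>q. (\<forall>i. q i \<in> R0 m) \<and> f + g = (\<Sum>i\<in>UNIV. q i * M_gen m a i)"
    by (intro exI[of _ "\<lambda>i. p i + q i"]) (auto simp: distrib_right sum.distrib R0_add)
qed

lemma M_ideal_mult: "f \<in> M_ideal m a \<Longrightarrow> g \<in> R0 m \<Longrightarrow> g * f \<in> M_ideal m a"
  unfolding M_ideal_iff
proof (elim exE conjE)
  fix p
  assume "\<forall>i. p i \<in> R0 m" "f = (\<Sum>i\<in>UNIV. p i * M_gen m a i)" "g \<in> R0 m"
  then show "\<exists>q. (\<forall>i. q i \<in> R0 m) \<and> g * f = (\<Sum>i\<in>UNIV. q i * M_gen m a i)"
    by (intro exI[of _ "\<lambda>i. g * p i"]) (auto simp: mult.assoc sum_distrib_left R0_mult)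
qed

lemma M_gen_mem: "M_gen m a i \<in> M_ideal m a"
proof -
  have "(\<Sum>j\<in>UNIV. (if j = i then 1 else 0) * M_gen m a j) = (\<Sum>j\<in>UNIV. if j = i then M_gen m a j else 0)"
    by (intro sum.cong) auto
  then show ?thesis
    unfolding M_ideal_iff by (intro exI[of _ "\<lambda>j. if j = i then 1 else 0"]) auto
qed

lemma M_ideal_eval_zero:
  assumes "f \<in> M_ideal m a" "\<And>i. b i \<noteq> 0" "\<And>i. b i ^ m i = a i"
  shows "laurent_eval b f = 0"
  using assms unfolding M_ideal_iff
  by (auto simp: laurent_eval_sum laurent_eval_mult laurent_eval_M_gen)

text \<open>The exponents in m_1 Z x ... x m_N Z whose monomial is congruent to its value at
  \<open>b\<close> modulo M_a form a subgroup. It contains the exponents of the t_i^(m_i), which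
  generate the whole lattice.\<close>

lemma M_ideal_monomial:
  fixes m :: "'n::finite \<Rightarrow> nat" and b :: "'n \<Rightarrow> 'f::field"
  assumes b: "\<And>i. b i \<noteq> 0" and a: "\<And>i. b i ^ m i = a i" and k: "\<And>i. int (m i) dvd k i"
  shows "Poly_Mapping.single k 1 - Poly_Mapping.single 0 (tpow b k) \<in> M_ideal m a"
proof -
  let ?d = "\<lambda>k. Poly_Mapping.single k 1 - Poly_Mapping.single 0 (tpow b k)"
  define S where "S = {k. (\<forall>i. int (m i) dvd k i) \<and> ?d k \<in> M_ideal m a}"
  have zero: "0 \<in> S"
    by (simp add: S_def)
  have add: "k + l \<in> S" if "k \<in> S" "l \<in> S" for k l
  proof -
    have "?d (k + l) = Poly_Mapping.single k 1 * ?d l + Poly_Mapping.single 0 (tpow b l) * ?d k"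
      by (simp only: tpow_add[of b, OF b] right_diff_distrib mult_single) (simp add: mult.commute)
    then show ?thesis
      using that by (auto simp: S_def intro!: M_ideal_add M_ideal_mult R0_single simp del: prod.distrib)
  qed
  have neg: "- k \<in> S" if "k \<in> S" for k
  proof -
    have "tpow b k * tpow b (- k) = 1"
      using tpow_add[of b k "- k"] b by (simp add: zero_fun_def)
    \<comment> \<open>This is t^(-k) - b^(-k) = - b^(-k) t^(-k) (t^k - b^k), so negatives stay in
      \<open>S\<close>.\<close>
    then have "?d (- k) = Poly_Mapping.single (- k) (- tpow b (- k)) * ?d k"
      by (simp only: right_diff_distrib mult_single)
        (simp add: mult.commute single_uminus fun_Compl_def zero_fun_def plus_fun_def)
    then show ?thesis
      using that by (auto simp: S_def intro!: M_ideal_mult R0_single)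
  qed
  define e where "e i = (\<lambda>j. if j = i then int (m i) else 0)" for i :: 'n
  have e: "e i \<in> S" for i
  proof -
    have "tpow b (e i) = (\<Prod>j\<in>UNIV. if j = i then b i ^ m i else 1)"
      by (intro prod.cong) (auto simp: e_def)
    then have "tpow b (e i) = a i"
      by (simp add: a)
    then have "?d (e i) = M_gen m a i"
      by (simp add: M_gen_def e_def)
    then show ?thesis
      using M_gen_mem by (auto simp: S_def e_def)
  qed
  have nat_mult: "(\<lambda>j. int n * e i j) \<in> S" for n i
  proof (induction n)
    case 0
    then show ?case
      using zero by (simp add: zero_fun_def)
  next
    case (Suc n)
    then show ?case
      using add[OF Suc e[of i]] by (simp add: plus_fun_def algebra_simps)
  qed
  have int_mult: "(\<lambda>j. z * e i j) \<in> S" for z i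
  proof (cases "0 \<le> z")
    case True
    then show ?thesis
      using nat_mult[of "nat z" i] by simp
  next
    case False
    then show ?thesis
      using neg[OF nat_mult[of "nat (- z)" i]] by (simp add: fun_Compl_def)
  qed
  have in_S: "(\<Sum>i\<in>A. (\<lambda>j. (k i div int (m i)) * e i j)) \<in> S" if "finite A" for A
    using that
  proof (induction A)
    case empty
    show ?case
      unfolding sum.empty by (rule zero)
  next
    case (insert i A)
    show ?case
      unfolding sum.insert[OF insert.hyps] by (rule add[OF int_mult insert.IH])
  qed
  \<comment> \<open>The divisions are exact because m_i divides k_i.\<close>
  have "(\<Sum>i\<in>UNIV. (\<lambda>j. (k i div int (m i)) * e i j)) = k"
  proof
    fix j
    have "(\<Sum>i\<in>UNIV. (\<lambda>j. (k i div int (m i)) * e i j)) j = (\<Sum>i\<in>UNIV. (k i div int (m i)) * e i j)"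
      by (rule sum_apply)
    also have "\<dots> = (\<Sum>i\<in>UNIV. if i = j then k j else 0)"
      using k by (intro sum.cong) (auto simp: e_def)
    finally show "(\<Sum>i\<in>UNIV. (\<lambda>j. (k i div int (m i)) * e i j)) j = k j"
      by simp
  qed
  with in_S[of UNIV] have "k \<in> S"
    by simp
  then show ?thesis
    by (simp add: S_def)
qed

text \<open>Subtracting from each monomial of \<open>f\<close> its value at \<open>b\<close> gives f
  - f(b) as a combination of the differences in \<open>M_ideal_monomial\<close>, and f(b) = 0.
  Together with \<open>M_ideal_eval_zero\<close> this identifies M_a with the kernel of evaluation
  at \<open>b\<close> on R_0.\<close>

lemma M_ideal_memI:
  fixes m :: "'n::finite \<Rightarrow> nat" and b :: "'n \<Rightarrow> 'f::field"
  assumes b: "\<And>i. b i \<noteq> 0" and a: "\<And>i. b i ^ m i = a i"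
    and f: "f \<in> R0 m" and zero: "laurent_eval b f = 0"
  shows "f \<in> M_ideal m a"
proof -
  let ?d = "\<lambda>k. Poly_Mapping.single k 1 - Poly_Mapping.single 0 (tpow b k)"
  let ?g = "\<lambda>k. Poly_Mapping.single 0 (Poly_Mapping.lookup f k) * ?d k"
  have sum: "(\<Sum>k\<in>A. ?g k) \<in> M_ideal m a" if "finite A" "A \<subseteq> Poly_Mapping.keys f" for A
    using that
  proof (induction A)
    case (insert k A)
    then have "\<And>i. int (m i) dvd k i"
      using f insert.prems by (auto simp: R0_def)
    then have "?g k \<in> M_ideal m a"
      by (intro M_ideal_mult M_ideal_monomial b a R0_const)
    moreover have "A \<subseteq> Poly_Mapping.keys f"
      using insert.prems by blast
    ultimately have "?g k + (\<Sum>k\<in>A. ?g k) \<in> M_ideal m a"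
      by (intro M_ideal_add insert.IH)
    then show ?case
      unfolding sum.insert[OF insert.hyps] .
  qed simp
  have single_sum: "(\<Sum>k\<in>A. Poly_Mapping.single 0 (h k)) = Poly_Mapping.single 0 (\<Sum>k\<in>A. h k)"
    for A :: "('n \<Rightarrow> int) set" and h :: "_ \<Rightarrow> 'f"
    by (induction A rule: infinite_finite_induct) (auto simp: single_add)
  have "?g k = Poly_Mapping.single k (Poly_Mapping.lookup f k) - Poly_Mapping.single 0 (Poly_Mapping.lookup f k * tpow b k)" for k
    by (simp only: right_diff_distrib mult_single) simp
  then have "(\<Sum>k\<in>Poly_Mapping.keys f. ?g k) =
      f - Poly_Mapping.single 0 (laurent_eval b f)"
    by (simp only: sum_subtractf flip: laurent_sum_single) (simp only: single_sum laurent_eval_def)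
  then show ?thesis
    using sum[of "Poly_Mapping.keys f"] zero by simp
qed

text \<open>The Lagrange product of one factor for each l \<noteq> j, with value 1 at b_j and 0 at
  b_l.\<close>

lemma laurent_interpolation:
  fixes a b :: "nat \<Rightarrow> 'n::finite \<Rightarrow> 'f::field"
  assumes b: "\<And>j i. j < r \<Longrightarrow> b j i \<noteq> 0" and a: "\<And>j i. j < r \<Longrightarrow> b j i ^ m i = a j i"
    and distinct: "\<And>j l. j < r \<Longrightarrow> l < r \<Longrightarrow> a j = a l \<Longrightarrow> j = l" and j: "j < r"
  shows "\<exists>p\<in>R0 m. \<forall>l<r. laurent_eval (b l) p = (if l = j then 1 else 0)"
proof -
  have "\<exists>g\<in>R0 m. laurent_eval (b j) g = 1 \<and> laurent_eval (b l) g = 0" if l: "l < r" "l \<noteq> j" for l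
  proof -
    obtain i where i: "a l i \<noteq> a j i"
      using distinct[of j l] l j by (metis ext)
    \<comment> \<open>The factor is (t_i^(m_i) - a_li) / (a_ji - a_li). It separates the points
      through their m-th powers, which differ, and so stays in R_0.\<close>
    show ?thesis
      using l i j b a
      by (intro bexI[of _ "Poly_Mapping.single 0 (inverse (a j i - a l i)) * M_gen m (a l) i"])
        (auto simp: laurent_eval_mult laurent_eval_M_gen intro: R0_mult M_gen_R0)
  qed
  then obtain g where g: "\<And>l. l < r \<Longrightarrow> l \<noteq> j \<Longrightarrow> g l \<in> R0 m"
    "\<And>l. l < r \<Longrightarrow> l \<noteq> j \<Longrightarrow> laurent_eval (b j) (g l) = 1"
    "\<And>l. l < r \<Longrightarrow> l \<noteq> j \<Longrightarrow> laurent_eval (b l) (g l) = 0"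
    by metis
  let ?p = "\<Prod>l\<in>{..<r} - {j}. g l"
  have "laurent_eval (b l) ?p = (if l = j then 1 else 0)" if "l < r" for l
    using that g(2,3) by (subst laurent_eval_prod) (auto simp: b)
  moreover have "?p \<in> R0 m"
    using g(1) by (intro R0_prod) auto
  ultimately show ?thesis
    by blast
qed

section \<open>Ideals of the multiloop algebra\<close>

locale multiloop_bases = multiloop_setup sc br \<sigma> m \<xi>
  for sc :: "'f::field_char_0 \<Rightarrow> 'g::ab_group_add \<Rightarrow> 'g" (infixr "\<cdot>" 75)
    and br :: "'g \<Rightarrow> 'g \<Rightarrow> 'g"
    and \<sigma> :: "'n::finite \<Rightarrow> 'g \<Rightarrow> 'g"
    and m :: "'n \<Rightarrow> nat"
    and \<xi> :: "'n \<Rightarrow> 'f" +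
  fixes B :: "('n \<Rightarrow> int) \<Rightarrow> 'g set"
  assumes basis: "\<And>c. c \<in> Gset m \<Longrightarrow> independent (B c) \<and> span (B c) = grade_space sc \<sigma> \<xi> c"
begin

abbreviation L :: "(('n \<Rightarrow> int) \<Rightarrow> 'g) set" where
  "L \<equiv> multiloop sc \<sigma> \<xi>"

definition homog :: "('n \<Rightarrow> int) \<Rightarrow> 'g \<Rightarrow> ('n \<Rightarrow> int) \<Rightarrow> 'g" where
  "homog d y = (\<lambda>k. if k = d then y else 0)"

text \<open>The pure tensor of \<open>u\<close> and \<open>f\<close> in the full space, which need
  not lie in \<open>L\<close>; \<open>graded_part\<close> cuts it down to one class of
  exponents.\<close>

definition tensor :: "'g \<Rightarrow> (('n \<Rightarrow> int) \<Rightarrow>\<^sub>0 'f) \<Rightarrow> ('n \<Rightarrow> int) \<Rightarrow> 'g" where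
  "tensor u f = (\<lambda>k. Poly_Mapping.lookup f k \<cdot> u)"

definition graded_part :: "('n \<Rightarrow> int) \<Rightarrow> (('n \<Rightarrow> int) \<Rightarrow> 'g) \<Rightarrow> ('n \<Rightarrow> int) \<Rightarrow> 'g" where
  "graded_part c x = (\<lambda>k. if red m k = red m c then x k else 0)"

definition loop_ideal :: "(('n \<Rightarrow> int) \<Rightarrow> 'g) set \<Rightarrow> bool" where
  "loop_ideal K \<longleftrightarrow> K \<subseteq> L \<and> 0 \<in> K \<and> (\<forall>x\<in>K. \<forall>y\<in>K. x + y \<in> K) \<and>
     (\<forall>c. \<forall>x\<in>K. Lscale sc c x \<in> K) \<and> (\<forall>x\<in>L. \<forall>y\<in>K. Lbr br x y \<in> K)"

lemma B_finite: "c \<in> Gset m \<Longrightarrow> finite (B c)"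
  using basis finite_dim_bound by metis

lemma B_mem: "c \<in> Gset m \<Longrightarrow> e \<in> B c \<Longrightarrow> e \<in> gr c"
  using basis span_base by metis

lemma B_nonzero: "c \<in> Gset m \<Longrightarrow> e \<in> B c \<Longrightarrow> e \<noteq> 0"
  using basis dependent_zero by metis

lemma L_gr: "x \<in> L \<Longrightarrow> x k \<in> gr k"
  and L_finite: "x \<in> L \<Longrightarrow> finite {k. x k \<noteq> 0}"
  by (auto simp: multiloop_def)

lemma L_zero: "0 \<in> L"
  by (simp add: multiloop_def)

lemma L_add: "x \<in> L \<Longrightarrow> y \<in> L \<Longrightarrow> x + y \<in> L"
proof -
  assume xy: "x \<in> L" "y \<in> L"
  have "{k. (x + y) k \<noteq> 0} \<subseteq> {k. x k \<noteq> 0} \<union> {k. y k \<noteq> 0}"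
    by auto
  then show ?thesis
    using xy by (auto simp: multiloop_def gr_add intro: finite_subset)
qed

lemma L_sum: "(\<And>i. i \<in> A \<Longrightarrow> f i \<in> L) \<Longrightarrow> sum f A \<in> L"
  by (induction A rule: infinite_finite_induct) (auto simp: L_zero L_add simp del: plus_fun_apply zero_fun_apply)

lemma L_homog: "y \<in> gr d \<Longrightarrow> homog d y \<in> L"
  by (auto simp: multiloop_def homog_def)

lemma Lbr_superset:
  assumes "finite A" "{j. x j \<noteq> 0} \<subseteq> A"
  shows "Lbr br x y k = (\<Sum>j\<in>A. br (x j) (y (k - j)))"
  unfolding Lbr_def using assms by (intro sum.mono_neutral_left) auto

lemma Lbr_homog: "Lbr br (homog d y) x = (\<lambda>k. br y (x (k - d)))"
proof
  fix k
  have "Lbr br (homog d y) x k = (\<Sum>j\<in>{d}. br (homog d y j) (x (k - j)))"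
    by (rule Lbr_superset) (auto simp: homog_def)
  then show "Lbr br (homog d y) x k = br y (x (k - d))"
    by (simp add: homog_def)
qed

lemma Lbr_support:
  assumes "Lbr br x y k \<noteq> 0"
  obtains j l where "x j \<noteq> 0" "y l \<noteq> 0" "k = j + l"
proof -
  obtain j where "x j \<noteq> 0" "br (x j) (y (k - j)) \<noteq> 0"
    using assms unfolding Lbr_def by (metis (mono_tags, lifting) mem_Collect_eq sum.neutral)
  moreover have "k = j + (k - j)"
    by simp
  ultimately show ?thesis
    using that br_zero_right by metis
qed

lemma L_Lbr:
  assumes x: "x \<in> L" and y: "y \<in> L"
  shows "Lbr br x y \<in> L"
proof -
  have "{k. Lbr br x y k \<noteq> 0} \<subseteq> (\<lambda>(j, l). j + l) ` ({j. x j \<noteq> 0} \<times> {l. y l \<noteq> 0})"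
  proof
    fix k assume "k \<in> {k. Lbr br x y k \<noteq> 0}"
    then obtain j l where "x j \<noteq> 0" "y l \<noteq> 0" "k = j + l"
      using Lbr_support by blast
    then show "k \<in> (\<lambda>(j, l). j + l) ` ({j. x j \<noteq> 0} \<times> {l. y l \<noteq> 0})"
      by (intro image_eqI[of _ _ "(j, l)"]) auto
  qed
  then have "finite {k. Lbr br x y k \<noteq> 0}"
    using L_finite[OF x] L_finite[OF y] by (auto intro: finite_subset)
  moreover have "Lbr br x y k \<in> gr k" for k
    unfolding Lbr_def
  proof (rule gr_sum)
    fix j
    have "br (x j) (y (k - j)) \<in> gr (j + (k - j))"
      by (intro gr_br L_gr x y)
    then show "br (x j) (y (k - j)) \<in> gr k"
      by simp
  qed
  ultimately show ?thesis
    by (simp add: multiloop_def)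
qed

lemma lookup_coord_proj:
  assumes "x \<in> L" "c \<in> Gset m"
  shows "Poly_Mapping.lookup (coord_proj sc m B c e x) k =
    (if red m k = c then representation (B c) (x k) e else 0)"
proof -
  have fin: "finite {k. x k \<noteq> 0 \<and> red m k = c}"
    using L_finite[OF assms(1)] by (rule rev_finite_subset) auto
  have "Poly_Mapping.lookup (coord_proj sc m B c e x) k =
    (\<Sum>l\<in>{k. x k \<noteq> 0 \<and> red m k = c}. if l = k then representation (B c) (x k) e else 0)"
    unfolding coord_proj_def lookup_sum
    by (intro sum.cong) (auto simp: lookup_single when_def)
  then show ?thesis
    using fin by (auto simp: representation_zero)
qed

lemma sum_representation:
  assumes "u \<in> gr c" "c \<in> Gset m"
  shows "(\<Sum>e\<in>B c. representation (B c) u e \<cdot> e) = u"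
  using assms basis by (intro sum_representation_eq) (auto simp: B_finite)

text \<open>At the exponent \<open>k\<close> only c = \<open>red m k\<close> contributes, through
  the basis expansion of \<open>x k\<close>. Here \<open>graded_part\<close> changes nothing; it
  gives the summands the shape treated by \<open>graded_tensor_mem\<close> and
  \<open>L_graded_tensor\<close>.\<close>

lemma coord_proj_expansion:
  assumes x: "x \<in> L"
  shows "x = (\<Sum>c\<in>Gset m. \<Sum>e\<in>B c. graded_part c (tensor e (coord_proj sc m B c e x)))"
proof
  fix k
  have "(\<Sum>c\<in>Gset m. \<Sum>e\<in>B c. graded_part c (tensor e (coord_proj sc m B c e x))) k =
      (\<Sum>c\<in>Gset m. \<Sum>e\<in>B c. graded_part c (tensor e (coord_proj sc m B c e x)) k)"
    by (simp add: sum_apply)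
  also have "\<dots> = (\<Sum>c\<in>Gset m. if c = red m k then x k else 0)"
  proof (rule sum.cong)
    fix c assume c: "c \<in> Gset m"
    show "(\<Sum>e\<in>B c. graded_part c (tensor e (coord_proj sc m B c e x)) k) = (if c = red m k then x k else 0)"
    proof (cases "c = red m k")
      case True
      have "x k \<in> gr c"
        using L_gr[OF x, of k] True by simp
      then have "(\<Sum>e\<in>B c. representation (B c) (x k) e \<cdot> e) = x k"
        using c by (rule sum_representation)
      then show ?thesis
        using True c by (simp add: graded_part_def tensor_def lookup_coord_proj[OF x])
    next
      case False
      then show ?thesis
        using c by (auto simp: graded_part_def intro!: sum.neutral)
    qed
  qed simp
  also have "\<dots> = x k"
    by (subst sum.delta) simp_all
  finally show "x k = (\<Sum>c\<in>Gset m. \<Sum>e\<in>B c. graded_part c (tensor e (coord_proj sc m B c e x))) k" ..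
qed

section \<open>Operators on g whose graded lifts preserve an ideal\<close>

lemma finite_bases: "finite (\<Union>c\<in>Gset m. B c)"
  by (auto simp: B_finite)

text \<open>Projection to the grade \<open>c\<close> fixes the other vectors of \<open>B c\<close>
  and kills all other bases, so a relation for \<open>e\<close> would already hold within
  \<open>B c\<close>. This is the hypothesis of \<open>density\<close>.\<close>

lemma basis_element_not_in_span:
  assumes c: "c \<in> Gset m" and e: "e \<in> B c"
  shows "e \<notin> span ((\<Union>c\<in>Gset m. B c) - {e})"
proof
  let ?S = "(\<Union>c\<in>Gset m. B c) - {e}"
  let ?W = "{u. proj c u \<in> span (B c - {e})}"
  assume "e \<in> span ?S"
  moreover have "?S \<subseteq> ?W"
  proof
    fix s assume s: "s \<in> ?S"
    then obtain d where d: "d \<in> Gset m" "s \<in> B d"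
      by blast
    show "s \<in> ?W"
    proof (cases "d = c")
      case True
      then have "proj c s = s"
        using proj_gr[OF B_mem[OF d], of c] by simp
      then show ?thesis
        using True d s by (simp add: span_base)
    next
      case False
      then have "proj c s = 0"
        using proj_gr[OF B_mem[OF d], of c] c d by simp
      then show ?thesis
        by (simp add: span_zero)
    qed
  qed
  moreover have "subspace ?W"
    by (auto simp: subspace_def proj_add proj_scale span_zero span_add span_scale)
  ultimately have "e \<in> ?W"
    using span_minimal by blast
  then have "e \<in> span (B c - {e})"
    using proj_gr[OF B_mem[OF c e], of c] by simp
  then show False
    using basis[OF c] e unfolding dependent_def by blast
qed

lemma basis_disjoint:
  assumes "c \<in> Gset m" "d \<in> Gset m" "e \<in> B c" "e \<in> B d"
  shows "c = d"
  using proj_gr[OF B_mem[OF assms(1,3)], of c] proj_gr[OF B_mem[OF assms(2,4)], of c]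
    B_nonzero[OF assms(1,3)] assms(1,2) by (auto split: if_splits)

text \<open>Composing \<open>E\<close> with the projection onto the grade of the target exponent picks out the homogeneous
  components of \<open>E\<close>; hence the density argument applies although \<open>E\<close> itself need not be homogeneous.\<close>

definition preserving_ops :: "(('n \<Rightarrow> int) \<Rightarrow> 'g) set \<Rightarrow> ('g \<Rightarrow> 'g) set" where
  "preserving_ops K = {E. Vector_Spaces.linear sc sc E \<and>
     (\<forall>x\<in>K. \<forall>l. (\<lambda>k. proj k (E (x (k - l)))) \<in> K)}"

lemma graded_tensor_add:
  "graded_part c (tensor u (f + g)) = graded_part c (tensor u f) + graded_part c (tensor u g)"
  by (auto simp: graded_part_def tensor_def lookup_add scale_left_distrib)

lemma graded_tensor_zero: "graded_part c (tensor u 0) = 0"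
  by (auto simp: graded_part_def tensor_def)

context
  fixes K assumes K: "loop_ideal K"
begin

lemma K_L: "x \<in> K \<Longrightarrow> x \<in> L"
  and K_zero: "0 \<in> K"
  and K_add: "x \<in> K \<Longrightarrow> y \<in> K \<Longrightarrow> x + y \<in> K"
  and K_scale: "x \<in> K \<Longrightarrow> Lscale sc c x \<in> K"
  and K_br: "z \<in> L \<Longrightarrow> x \<in> K \<Longrightarrow> Lbr br z x \<in> K"
  using K by (auto simp: loop_ideal_def)

lemma K_sum: "(\<And>i. i \<in> A \<Longrightarrow> f i \<in> K) \<Longrightarrow> sum f A \<in> K"
  by (induction A rule: infinite_finite_induct) (auto simp: K_zero K_add simp del: plus_fun_apply zero_fun_apply)

lemma preserving_ops_add:
  assumes "E \<in> preserving_ops K" "E' \<in> preserving_ops K"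
  shows "(\<lambda>x. E x + E' x) \<in> preserving_ops K"
proof -
  have "(\<lambda>k. proj k (E (x (k - l)) + E' (x (k - l)))) \<in> K" if "x \<in> K" for x l
    using K_add[of "\<lambda>k. proj k (E (x (k - l)))" "\<lambda>k. proj k (E' (x (k - l)))"] assms that
    by (simp add: preserving_ops_def proj_add plus_fun_def)
  moreover have "Vector_Spaces.linear sc sc (\<lambda>x. E x + E' x)"
    using assms by (auto simp: preserving_ops_def linear_iff scale_right_distrib)
  ultimately show ?thesis
    by (simp add: preserving_ops_def)
qed

lemma preserving_ops_scale:
  assumes "E \<in> preserving_ops K"
  shows "(\<lambda>x. c \<cdot> E x) \<in> preserving_ops K"
proof -
  have "(\<lambda>k. proj k (c \<cdot> E (x (k - l)))) \<in> K" if "x \<in> K" for x l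
    using K_scale[of "\<lambda>k. proj k (E (x (k - l)))" c] assms that
    by (simp add: preserving_ops_def proj_scale Lscale_def)
  moreover have "Vector_Spaces.linear sc sc (\<lambda>x. c \<cdot> E x)"
    using assms by (auto simp: preserving_ops_def linear_iff scale_right_distrib scale_left_commute)
  ultimately show ?thesis
    by (simp add: preserving_ops_def)
qed

lemma preserving_ops_zero: "(\<lambda>x. 0) \<in> preserving_ops K"
  using K_zero by (auto simp: preserving_ops_def zero_fun_def linear_iff)

lemma preserving_ops_sum:
  "(\<And>i. i \<in> A \<Longrightarrow> E i \<in> preserving_ops K) \<Longrightarrow> (\<lambda>x. \<Sum>i\<in>A. E i x) \<in> preserving_ops K"
  by (induction A rule: infinite_finite_induct) (auto simp: preserving_ops_zero preserving_ops_add)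

lemma preserving_ops_homog_comp:
  assumes E: "E \<in> preserving_ops K" and y: "y \<in> gr d"
  shows "(\<lambda>x. br y (E x)) \<in> preserving_ops K"
proof -
  have "(\<lambda>k. proj k (br y (E (x (k - l))))) \<in> K" if x: "x \<in> K" for x l
  proof -
    \<comment> \<open>The bracket with y \<otimes> t^d adds \<open>d\<close> to the exponent, so the
      lift of \<open>E\<close> is taken with shift l - d to reach total shift
      \<open>l\<close>.\<close>
    let ?x = "\<lambda>k. proj k (E (x (k - (l - d))))"
    have "Lbr br (homog d y) ?x \<in> K"
      using E x y by (intro K_br L_homog) (auto simp: preserving_ops_def)
    moreover have "Lbr br (homog d y) ?x = (\<lambda>k. proj k (br y (E (x (k - l)))))"
    proof -
      have "k - d - (l - d) = k - l" for k :: "'n \<Rightarrow> int"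
        by simp
      then show ?thesis
        unfolding Lbr_homog proj_br[OF y] by (simp del: minus_apply)
    qed
    ultimately show ?thesis
      by simp
  qed
  moreover have "Vector_Spaces.linear sc sc (\<lambda>x. br y (E x))"
    using E by (auto simp: preserving_ops_def linear_iff br_add_right br_scale_right)
  ultimately show ?thesis
    by (simp add: preserving_ops_def)
qed

text \<open>This is not the composition lemma with \<open>E\<close> the identity: \<open>K\<close>
  is not assumed stable under R_0, so the identity is not known to preserve it. Since every
  \<open>x k\<close> is homogeneous, the projection is either trivial for all \<open>k\<close>, and
  y \<otimes> t^l lies in \<open>L\<close>, or it gives zero throughout.\<close>

lemma preserving_ops_homog_ad:
  assumes y: "y \<in> gr d"
  shows "br y \<in> preserving_ops K"
proof -
  have "(\<lambda>k. proj k (br y (x (k - l)))) \<in> K" if x: "x \<in> K" for x l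
  proof -
    have eq: "proj k (br y (x (k - l))) = (if red m (k - d) = red m (k - l) then br y (x (k - l)) else 0)" for k
      unfolding proj_br[OF y] using proj_gr[OF L_gr[OF K_L[OF x], of "k - l"], of "k - d"] by simp
    have iff: "red m (k - d) = red m (k - l) \<longleftrightarrow> red m l = red m d" for k
      using red_add_iff[of "k - d" "l + d - k" "k - l"] by (simp add: algebra_simps)
    show ?thesis
    proof (cases "red m l = red m d")
      case True
      then have "y \<in> gr l"
        using y gr_red_cong by blast
      then have "Lbr br (homog l y) x \<in> K"
        using x by (intro K_br L_homog)
      then show ?thesis
        using True by (simp add: eq iff Lbr_homog del: minus_apply)
    next
      case False
      then show ?thesis
        using K_zero by (simp add: eq iff zero_fun_def del: minus_apply)
    qed
  qed
  then show ?thesis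
    by (simp add: preserving_ops_def linear_br)
qed

lemma preserving_ops_comp:
  assumes "E \<in> preserving_ops K"
  shows "(\<lambda>x. br y (E x)) \<in> preserving_ops K"
proof -
  have "(\<lambda>x. \<Sum>c\<in>Gset m. br (proj c y) (E x)) \<in> preserving_ops K"
    by (intro preserving_ops_sum preserving_ops_homog_comp[OF assms proj_mem])
  then show ?thesis
    by (simp add: sum_proj flip: br_sum_left)
qed

lemma preserving_ops_ad: "br y \<in> preserving_ops K"
proof -
  have "(\<lambda>x. \<Sum>c\<in>Gset m. br (proj c y) x) \<in> preserving_ops K"
    by (intro preserving_ops_sum preserving_ops_homog_ad[OF proj_mem])
  then show ?thesis
    by (simp add: sum_proj flip: br_sum_left)
qed

text \<open>Density supplies an operator that sends \<open>e\<close> to \<open>e'\<close> and kills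
  every other basis vector. Its lift with shift \<open>l\<close> turns \<open>x\<close> into
  \<open>e'\<close> times t^l times the \<open>e\<close>-coordinate, restricted to the class of
  \<open>c'\<close>.\<close>

lemma tensor_monomial_mult_mem:
  assumes c: "c \<in> Gset m" and e: "e \<in> B c" and e': "e' \<in> gr c'" and x: "x \<in> K"
  shows "graded_part c' (tensor e' (Poly_Mapping.single l 1 * coord_proj sc m B c e x)) \<in> K"
proof -
  let ?S = "(\<Union>c\<in>Gset m. B c) - {e}"
  have "\<exists>E\<in>preserving_ops K. (\<forall>t\<in>?S. E t = 0) \<and> E e = e'"
  proof (rule density)
    show "e \<notin> span ?S"
      using c e by (rule basis_element_not_in_span)
    show "finite ?S"
      using finite_bases by simp
  qed (auto simp: preserving_ops_add preserving_ops_scale preserving_ops_comp preserving_ops_ad,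
      auto simp: preserving_ops_def)
  then obtain E where E: "E \<in> preserving_ops K" "\<And>t. t \<in> ?S \<Longrightarrow> E t = 0" "E e = e'"
    by blast
  interpret E: Vector_Spaces.linear sc sc E
    using E(1) by (simp add: preserving_ops_def)
  have Eu: "E u = (if red m d = c then representation (B c) u e \<cdot> e' else 0)" if u: "u \<in> gr d" for u d
  proof (cases "red m d = c")
    case True
    then have "u \<in> gr c"
      using u by auto
    then have "E u = E (\<Sum>f\<in>B c. representation (B c) u f \<cdot> f)"
      using c by (simp add: sum_representation)
    also have "\<dots> = (\<Sum>f\<in>B c. representation (B c) u f \<cdot> E f)"
      by (simp add: E.sum E.scale)
    also have "\<dots> = (\<Sum>f\<in>B c. if f = e then representation (B c) u e \<cdot> e' else 0)"
      using E(2,3) c by (intro sum.cong) auto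
    also have "\<dots> = representation (B c) u e \<cdot> e'"
      using c e B_finite by (subst sum.delta) auto
    finally show ?thesis
      using True by simp
  next
    \<comment> \<open>In a grade other than \<open>c\<close> the whole basis avoids
      \<open>e\<close>, so \<open>E\<close> kills that grade.\<close>
    case False
    then have "e \<notin> B (red m d)"
      using basis_disjoint[OF c red_mem e] by blast
    then have "B (red m d) \<subseteq> ?S"
      using red_mem by blast
    moreover have "u \<in> span (B (red m d))"
      using basis[of "red m d"] u by simp
    ultimately have "E u = 0"
      using E(2) by (intro E.eq_0_on_span[of "B (red m d)" u]) auto
    then show ?thesis
      using False by simp
  qed
  \<comment> \<open>As \<open>e'\<close> is homogeneous of grade \<open>c'\<close>,
    \<open>proj k\<close> keeps or kills it exactly as \<open>graded_part c'\<close> does.\<close>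
  have "graded_part c' (tensor e' (Poly_Mapping.single l 1 * coord_proj sc m B c e x)) k =
      proj k (E (x (k - l)))" for k
    unfolding Eu[OF L_gr[OF K_L[OF x]]] graded_part_def tensor_def lookup_single_mult
      lookup_coord_proj[OF K_L[OF x] c]
    using proj_gr[OF e', of k] by (simp add: proj_scale)
  then have "graded_part c' (tensor e' (Poly_Mapping.single l 1 * coord_proj sc m B c e x)) =
      (\<lambda>k. proj k (E (x (k - l))))"
    by blast
  then show ?thesis
    using E(1) x by (simp add: preserving_ops_def)
qed

lemma graded_tensor_mult_mem:
  assumes c: "c \<in> Gset m" and e: "e \<in> B c" and e': "e' \<in> gr c'" and x: "x \<in> K"
  shows "graded_part c' (tensor e' (q * coord_proj sc m B c e x)) \<in> K"
proof (induction q rule: laurent_induct)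
  case zero
  show ?case
    unfolding mult_zero_left graded_tensor_zero by (rule K_zero)
next
  case (single_add l a q)
  have "Poly_Mapping.single l a * f = Poly_Mapping.single 0 a * (Poly_Mapping.single l 1 * f)" for f
    by (simp add: mult_single flip: mult.assoc)
  then have "graded_part c' (tensor e' (Poly_Mapping.single l a * coord_proj sc m B c e x)) =
      Lscale sc a (graded_part c' (tensor e' (Poly_Mapping.single l 1 * coord_proj sc m B c e x)))"
    by (auto simp: graded_part_def tensor_def Lscale_def lookup_single_mult)
  then show ?case
    using single_add K_scale[OF tensor_monomial_mult_mem[OF assms]]
    by (simp add: distrib_right graded_tensor_add K_add del: plus_fun_apply)
qed

end

end

text \<open>R as a module over itself, whose spans are the ideals of R generated by a set, as in
  \<open>ideal_I\<close>.\<close>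

interpretation laurent_module: module "(*) :: (('n \<Rightarrow> int) \<Rightarrow>\<^sub>0 'f::field) \<Rightarrow> _ \<Rightarrow> _"
  by unfold_locales (auto simp: algebra_simps)

section \<open>Membership in an ideal K from membership in I(K)\<close>

context multiloop_bases
begin

lemma coord_proj_ideal_I:
  "c \<in> Gset m \<Longrightarrow> e \<in> B c \<Longrightarrow> x \<in> K \<Longrightarrow> coord_proj sc m B c e x \<in> ideal_I sc m B K"
  unfolding ideal_I_def by (intro laurent_module.span_base) blast

lemma ideal_I_mult: "f \<in> ideal_I sc m B K \<Longrightarrow> q * f \<in> ideal_I sc m B K"
  unfolding ideal_I_def by (rule laurent_module.span_scale)

lemma graded_tensor_mem:
  assumes K: "loop_ideal K" and f: "f \<in> ideal_I sc m B K" and e': "e' \<in> gr c'"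
  shows "graded_part c' (tensor e' f) \<in> K"
proof -
  \<comment> \<open>The multiplier \<open>q\<close> is part of the induction claim because the step
    multiplies the generator by a further \<open>p\<close>; q = 1 is taken at the end.\<close>
  have "\<forall>q. graded_part c' (tensor e' (q * f)) \<in> K"
    using f unfolding ideal_I_def
  proof (induction rule: laurent_module.span_induct_alt)
    case base
    then show ?case
      unfolding mult_zero_right graded_tensor_zero using K_zero[OF K] by blast
  next
    case (step p g h)
    show ?case
    proof
      fix q
      obtain c e x where g: "c \<in> Gset m" "e \<in> B c" "x \<in> K" "g = coord_proj sc m B c e x"
        using step by blast
      have "graded_part c' (tensor e' ((q * p) * g)) + graded_part c' (tensor e' (q * h)) \<in> K"
        using step g graded_tensor_mult_mem[OF K _ _ e'] by (intro K_add[OF K]) auto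
      then show "graded_part c' (tensor e' (q * (p * g + h))) \<in> K"
        unfolding distrib_left mult.assoc graded_tensor_add .
    qed
  qed
  from this[THEN spec, of 1] show ?thesis
    by simp
qed

text \<open>A coordinate of grade \<open>c\<close> has all exponents congruent to \<open>c\<close>.
  The shift brings it into R_0, where the description of I by the points a_j applies.\<close>

lemma coord_shift_R0:
  assumes "x \<in> L" "c \<in> Gset m"
  shows "Poly_Mapping.single (- c) 1 * coord_proj sc m B c e x \<in> R0 m"
proof -
  have "int (m i) dvd k i"
    if "k \<in> Poly_Mapping.keys (Poly_Mapping.single (- c) 1 * coord_proj sc m B c e x)" for k i
  proof -
    have "red m (k - - c) = c"
      using that unfolding in_keys_iff lookup_single_mult lookup_coord_proj[OF assms]
      by (auto split: if_splits)
    then have "red m (k + c) = red m (0 + c)"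
      using assms(2) by simp
    then have "red m k = red m 0"
      unfolding red_add_iff .
    then show ?thesis
      by (auto simp: red_eq_iff)
  qed
  then show ?thesis
    by (auto simp: R0_def)
qed

end

section \<open>The evaluation map\<close>

context multiloop_bases
begin

lemma eval_superset:
  assumes "finite A" "{k. x k \<noteq> 0} \<subseteq> A"
  shows "eval_at sc b x = (\<Sum>k\<in>A. tpow b k \<cdot> x k)"
  unfolding eval_at_def using assms by (intro sum.mono_neutral_left) auto

lemma eval_add:
  assumes "x \<in> L" "y \<in> L"
  shows "eval_at sc b (x + y) = eval_at sc b x + eval_at sc b y"
proof -
  let ?A = "{k. x k \<noteq> 0} \<union> {k. y k \<noteq> 0}"
  have "finite ?A"
    using assms by (simp add: L_finite)
  then have "eval_at sc b z = (\<Sum>k\<in>?A. tpow b k \<cdot> z k)" if "z \<in> {x, y, x + y}" for z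
    using that by (intro eval_superset) auto
  then show ?thesis
    by (simp add: scale_right_distrib sum.distrib)
qed

lemma eval_zero [simp]: "eval_at sc b 0 = 0"
  by (simp add: eval_at_def)

lemma eval_sum:
  assumes "\<And>i. i \<in> A \<Longrightarrow> f i \<in> L"
  shows "eval_at sc b (sum f A) = (\<Sum>i\<in>A. eval_at sc b (f i))"
  using assms
proof (induction A rule: infinite_finite_induct)
  case (insert i A)
  have "f i \<in> L" "sum f A \<in> L"
    using insert.prems by (auto intro: L_sum)
  then show ?case
    using insert.hyps insert.IH insert.prems by (simp add: eval_add del: plus_fun_apply)
qed simp_all

lemma eval_scale:
  assumes "x \<in> L"
  shows "eval_at sc b (Lscale sc c x) = c \<cdot> eval_at sc b x"
proof -
  have "eval_at sc b z = (\<Sum>k\<in>{k. x k \<noteq> 0}. tpow b k \<cdot> z k)" if "z \<in> {x, Lscale sc c x}" for z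
    using that L_finite[OF assms] by (intro eval_superset) (auto simp: Lscale_def)
  then show ?thesis
    by (simp add: Lscale_def scale_sum_right scale_left_commute mult.commute)
qed

lemma eval_Lbr:
  assumes x: "x \<in> L" and y: "y \<in> L" and b: "\<And>i. b i \<noteq> 0"
  shows "eval_at sc b (Lbr br x y) = br (eval_at sc b x) (eval_at sc b y)"
proof -
  let ?A = "{j. x j \<noteq> 0}" and ?C = "{l. y l \<noteq> 0}"
  \<comment> \<open>\<open>D\<close> contains the support of the bracket and, for every
    \<open>j\<close> in the support of \<open>x\<close>, the translate by \<open>j\<close> of the
    support of \<open>y\<close>; with this common index set the two sums can be swapped.\<close>
  define D where "D = (\<lambda>(j, l). j + l) ` (?A \<times> ?C)"
  have fin: "finite ?A" "finite ?C" "finite D"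
    using L_finite[OF x] L_finite[OF y] by (auto simp: D_def)
  have sub: "{k. Lbr br x y k \<noteq> 0} \<subseteq> D"
  proof
    fix k assume "k \<in> {k. Lbr br x y k \<noteq> 0}"
    then obtain j l where "x j \<noteq> 0" "y l \<noteq> 0" "k = j + l"
      using Lbr_support by blast
    then show "k \<in> D"
      unfolding D_def by (intro image_eqI[of _ _ "(j, l)"]) auto
  qed
  have inner: "(\<Sum>k\<in>D. tpow b k \<cdot> br (x j) (y (k - j))) = br (tpow b j \<cdot> x j) (eval_at sc b y)"
    if j: "j \<in> ?A" for j
  proof -
    have "(\<Sum>k\<in>D. tpow b k \<cdot> br (x j) (y (k - j))) = (\<Sum>k\<in>(+) j ` ?C. tpow b k \<cdot> br (x j) (y (k - j)))"
    proof (rule sum.mono_neutral_right)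
      show "(+) j ` ?C \<subseteq> D"
        using j by (auto simp: D_def simp del: plus_fun_apply)
      show "\<forall>k\<in>D - (+) j ` ?C. tpow b k \<cdot> br (x j) (y (k - j)) = 0"
      proof
        fix k assume k: "k \<in> D - (+) j ` ?C"
        have "k = j + (k - j)"
          by simp
        with k have "y (k - j) = 0"
          by blast
        then show "tpow b k \<cdot> br (x j) (y (k - j)) = 0"
          by simp
      qed
    qed (use fin in auto)
    also have "\<dots> = (\<Sum>l\<in>?C. tpow b (j + l) \<cdot> br (x j) (y (j + l - j)))"
      by (subst sum.reindex) (auto simp: inj_on_def)
    also have "\<dots> = (\<Sum>l\<in>?C. br (tpow b j \<cdot> x j) (tpow b l \<cdot> y l))"
    proof (rule sum.cong)
      fix l
      have "j + l - j = l"
        by simp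
      then show "tpow b (j + l) \<cdot> br (x j) (y (j + l - j)) = br (tpow b j \<cdot> x j) (tpow b l \<cdot> y l)"
        unfolding tpow_add[of b j l, OF b] br_scale_left br_scale_right by simp
    qed simp
    finally show ?thesis
      by (simp add: eval_at_def br_sum_right)
  qed
  have "eval_at sc b (Lbr br x y) = (\<Sum>k\<in>D. tpow b k \<cdot> Lbr br x y k)"
    using fin sub by (intro eval_superset)
  also have "\<dots> = (\<Sum>k\<in>D. \<Sum>j\<in>?A. tpow b k \<cdot> br (x j) (y (k - j)))"
    by (simp add: Lbr_def scale_sum_right)
  also have "\<dots> = (\<Sum>j\<in>?A. \<Sum>k\<in>D. tpow b k \<cdot> br (x j) (y (k - j)))"
    by (rule sum.swap)
  also have "\<dots> = (\<Sum>j\<in>?A. br (tpow b j \<cdot> x j) (eval_at sc b y))"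
    by (intro sum.cong inner) simp
  finally show ?thesis
    by (simp add: eval_at_def[of sc b x] br_sum_left)
qed

lemma eval_tensor: "eval_at sc b (tensor u f) = laurent_eval b f \<cdot> u"
proof -
  have "eval_at sc b (tensor u f) = (\<Sum>k\<in>Poly_Mapping.keys f. tpow b k \<cdot> tensor u f k)"
    by (rule eval_superset) (auto simp: tensor_def in_keys_iff)
  then show ?thesis
    by (simp add: tensor_def laurent_eval_def scale_sum_left mult.commute)
qed

lemma graded_part_coord_proj:
  assumes "x \<in> L" "c \<in> Gset m"
  shows "graded_part c (tensor u (coord_proj sc m B c e x)) = tensor u (coord_proj sc m B c e x)"
  using assms by (auto simp: graded_part_def tensor_def lookup_coord_proj)

lemma L_graded_tensor:
  assumes "u \<in> gr c"
  shows "graded_part c (tensor u f) \<in> L"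
proof -
  have "{k. graded_part c (tensor u f) k \<noteq> 0} \<subseteq> Poly_Mapping.keys f"
    by (auto simp: graded_part_def tensor_def in_keys_iff)
  then have "finite {k. graded_part c (tensor u f) k \<noteq> 0}"
    by (rule finite_subset) simp
  moreover have "graded_part c (tensor u f) k \<in> gr k" for k
    using assms gr_red_cong[of k c] by (auto simp: graded_part_def tensor_def gr_scale)
  ultimately show ?thesis
    by (simp add: multiloop_def)
qed

lemma eval_expansion:
  assumes x: "x \<in> L"
  shows "eval_at sc b x = (\<Sum>c\<in>Gset m. \<Sum>e\<in>B c. laurent_eval b (coord_proj sc m B c e x) \<cdot> e)"
proof -
  let ?t = "\<lambda>c e. graded_part c (tensor e (coord_proj sc m B c e x))"
  have L: "?t c e \<in> L" if "c \<in> Gset m" "e \<in> B c" for c e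
    using that by (intro L_graded_tensor B_mem)
  have "eval_at sc b x = eval_at sc b (\<Sum>c\<in>Gset m. \<Sum>e\<in>B c. ?t c e)"
    by (subst coord_proj_expansion[OF x]) simp
  also have "\<dots> = (\<Sum>c\<in>Gset m. eval_at sc b (\<Sum>e\<in>B c. ?t c e))"
    using L by (intro eval_sum L_sum)
  also have "\<dots> = (\<Sum>c\<in>Gset m. \<Sum>e\<in>B c. eval_at sc b (?t c e))"
    using L by (intro sum.cong refl eval_sum)
  also have "\<dots> = (\<Sum>c\<in>Gset m. \<Sum>e\<in>B c. laurent_eval b (coord_proj sc m B c e x) \<cdot> e)"
    by (intro sum.cong refl) (simp add: graded_part_coord_proj[OF x] eval_tensor)
  finally show ?thesis .
qed

text \<open>In \<open>eval_expansion\<close> the inner sums lie in different grades, so each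
  vanishes, and independence of \<open>B c\<close> then kills the coefficients.\<close>

lemma eval_zero_coord:
  assumes x: "x \<in> L" and zero: "eval_at sc b x = 0" and c: "c \<in> Gset m" and e: "e \<in> B c"
  shows "laurent_eval b (coord_proj sc m B c e x) = 0"
proof -
  let ?u = "\<lambda>c. \<Sum>e\<in>B c. laurent_eval b (coord_proj sc m B c e x) \<cdot> e"
  have "?u c = 0"
  proof (rule gr_independent[of "Gset m" ?u])
    show "?u c \<in> gr c" if "c \<in> Gset m" for c
      using that by (intro gr_sum gr_scale B_mem)
    show "(\<Sum>c\<in>Gset m. ?u c) = 0"
      using eval_expansion[OF x, of b] zero by simp
  qed (use c in auto)
  then show ?thesis
    using basis[OF c] B_finite[OF c] e
    by (intro independentD[of "B c" "B c" "\<lambda>e. laurent_eval b (coord_proj sc m B c e x)" e]) auto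
qed

section \<open>The kernel of the evaluation map\<close>

lemma coord_shift:
  "Poly_Mapping.single c 1 * (Poly_Mapping.single (- c) 1 * f) = (f :: ('n \<Rightarrow> int) \<Rightarrow>\<^sub>0 'f)"
proof -
  have "c + - c = 0"
    by simp
  then have "Poly_Mapping.single c 1 * Poly_Mapping.single (- c) 1 = (1 :: ('n \<Rightarrow> int) \<Rightarrow>\<^sub>0 'f)"
    unfolding mult_single by simp
  then show ?thesis
    by (simp flip: mult.assoc)
qed

lemma loop_ideal_rep_kernel:
  assumes rep: "representation_of sc br \<sigma> \<xi> scV \<phi>"
  shows "loop_ideal (rep_kernel sc \<sigma> \<xi> \<phi>)"
proof -
  have add: "\<phi> (x + y) v = \<phi> x v + \<phi> y v" if "x \<in> L" "y \<in> L" for x y v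
    using rep that by (simp add: representation_of_def Ladd_def plus_fun_def)
  have scale: "\<phi> (Lscale sc c x) v = scV c (\<phi> x v)" if "x \<in> L" for x c v
    using rep that by (simp add: representation_of_def)
  have br: "\<phi> (Lbr br x y) v = \<phi> x (\<phi> y v) - \<phi> y (\<phi> x v)" if "x \<in> L" "y \<in> L" for x y v
    using rep that by (simp add: representation_of_def)
  have lin0: "\<phi> x 0 = 0" if "x \<in> L" for x
  proof -
    interpret X: Vector_Spaces.linear scV scV "\<phi> x"
      using rep that by (simp add: representation_of_def)
    show ?thesis
      by (rule X.zero)
  qed
  have scV0: "scV c 0 = 0" for c
  proof -
    interpret V: vector_space scV
      using rep by (simp add: representation_of_def)
    show ?thesis
      by simp
  qed
  have "\<phi> 0 v = 0" for v
    using add[OF L_zero L_zero, of v] by simp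
  moreover have "Lscale sc c x \<in> L" if "x \<in> L" for x c
  proof -
    have "{k. Lscale sc c x k \<noteq> 0} \<subseteq> {k. x k \<noteq> 0}"
      by (auto simp: Lscale_def)
    then show ?thesis
      using that by (auto simp: multiloop_def Lscale_def gr_scale intro: finite_subset)
  qed
  ultimately show ?thesis
    by (auto simp: loop_ideal_def rep_kernel_def L_zero L_add L_Lbr add scale br lin0 scV0
        simp del: plus_fun_apply zero_fun_apply)
qed

text \<open>A coordinate shifted into R_0 lies in I(K) and so in M_a, hence vanishes at
  \<open>b\<close>. The value of the shifting monomial is nonzero, so the coordinate itself vanishes
  there.\<close>

lemma ideal_eval_zero:
  assumes K: "loop_ideal K" and b: "\<And>i. b i \<noteq> 0" and a: "\<And>i. b i ^ m i = a i"
    and sub: "ideal_I sc m B K \<inter> R0 m \<subseteq> M_ideal m a" and x: "x \<in> K"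
  shows "eval_at sc b x = 0"
proof -
  have xL: "x \<in> L"
    using K x by (auto simp: loop_ideal_def)
  have "laurent_eval b (coord_proj sc m B c e x) = 0" if c: "c \<in> Gset m" and e: "e \<in> B c" for c e
  proof -
    let ?f = "Poly_Mapping.single (- c) 1 * coord_proj sc m B c e x"
    have "?f \<in> M_ideal m a"
      using sub coord_shift_R0[OF xL c] ideal_I_mult[OF coord_proj_ideal_I[OF c e x]] by blast
    then have "laurent_eval b ?f = 0"
      using b a by (rule M_ideal_eval_zero)
    then show ?thesis
      by (simp add: laurent_eval_mult[of b, OF b] b)
  qed
  then show ?thesis
    unfolding eval_expansion[OF xL] by simp
qed

text \<open>All shifted coordinates vanish at every b_j, so they lie in each M_(a_j) and thus in
  I(K). Shifting back stays in I(K), and \<open>graded_tensor_mem\<close> places each summand of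
  \<open>coord_proj_expansion\<close> in \<open>K\<close>.\<close>

lemma eval_zero_imp_mem:
  assumes K: "loop_ideal K" and b: "\<And>j i. j < r \<Longrightarrow> b j i \<noteq> 0" and a: "\<And>j i. j < r \<Longrightarrow> b j i ^ m i = a j i"
    and sup: "R0 m \<inter> (\<Inter>j\<in>{..<r}. M_ideal m (a j)) \<subseteq> ideal_I sc m B K"
    and x: "x \<in> L" and zero: "\<And>j. j < r \<Longrightarrow> eval_at sc (b j) x = 0"
  shows "x \<in> K"
proof -
  have "graded_part c (tensor e (coord_proj sc m B c e x)) \<in> K" if c: "c \<in> Gset m" and e: "e \<in> B c" for c e
  proof -
    let ?f = "Poly_Mapping.single (- c) 1 * coord_proj sc m B c e x"
    have R0: "?f \<in> R0 m"
      using x c by (rule coord_shift_R0)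
    moreover have "?f \<in> M_ideal m (a j)" if j: "j < r" for j
    proof (rule M_ideal_memI[of "b j"])
      show "laurent_eval (b j) ?f = 0"
        using eval_zero_coord[OF x zero[OF j] c e] b[OF j] by (simp add: laurent_eval_mult)
    qed (use b a j R0 in auto)
    ultimately have "?f \<in> ideal_I sc m B K"
      using sup by blast
    from ideal_I_mult[OF this, of "Poly_Mapping.single c 1"]
    have "coord_proj sc m B c e x \<in> ideal_I sc m B K"
      by (simp only: coord_shift)
    then show ?thesis
      using K B_mem[OF c e] by (intro graded_tensor_mem)
  qed
  then have "(\<Sum>c\<in>Gset m. \<Sum>e\<in>B c. graded_part c (tensor e (coord_proj sc m B c e x))) \<in> K"
    by (intro K_sum[OF K])
  then show ?thesis
    using coord_proj_expansion[OF x] by simp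
qed

section \<open>Surjectivity of the evaluation map\<close>

lemma L_tensor_R0:
  assumes p: "p \<in> R0 m" and u: "u \<in> gr c"
  shows "tensor u (Poly_Mapping.single c 1 * p) \<in> L"
proof -
  have "graded_part c (tensor u (Poly_Mapping.single c 1 * p)) k = tensor u (Poly_Mapping.single c 1 * p) k" for k
  proof (cases "Poly_Mapping.lookup p (k - c) = 0")
    case False
    then have "\<forall>i. int (m i) dvd (k - c) i"
      using p by (auto simp: R0_def in_keys_iff simp del: minus_apply)
    then have "red m k = red m c"
      by (simp add: red_eq_iff mod_eq_dvd_iff)
    then show ?thesis
      by (simp add: graded_part_def)
  qed (simp add: graded_part_def tensor_def lookup_single_mult)
  then have "graded_part c (tensor u (Poly_Mapping.single c 1 * p)) = tensor u (Poly_Mapping.single c 1 * p)"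
    by blast
  then show ?thesis
    using L_graded_tensor[OF u] by metis
qed

lemma eval_surjective:
  fixes y :: "nat \<Rightarrow> 'g"
  assumes b: "\<And>j i. j < r \<Longrightarrow> b j i \<noteq> 0" and a: "\<And>j i. j < r \<Longrightarrow> b j i ^ m i = a j i"
    and distinct: "\<And>j l. j < r \<Longrightarrow> l < r \<Longrightarrow> a j = a l \<Longrightarrow> j = l"
  shows "\<exists>x\<in>L. \<forall>j<r. eval_at sc (b j) x = y j"
proof -
  have "\<forall>j<r. \<exists>p\<in>R0 m. \<forall>l<r. laurent_eval (b l) p = (if l = j then 1 else 0)"
    using laurent_interpolation[of r b m a] b a distinct by blast
  then obtain p where p: "\<And>j. j < r \<Longrightarrow> p j \<in> R0 m"
    "\<And>j l. j < r \<Longrightarrow> l < r \<Longrightarrow> laurent_eval (b l) (p j) = (if l = j then 1 else 0)"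
    by metis
  \<comment> \<open>The monomial t^c moves the interpolation polynomial from R_0 to the grade of
    \<open>proj c (y j)\<close>, and the inverse factor cancels the value of t^c at b_j.\<close>
  define z where "z j c = tensor (inverse (tpow (b j) c) \<cdot> proj c (y j)) (Poly_Mapping.single c 1 * p j)" for j c
  have zL: "z j c \<in> L" if "j < r" for j c
    unfolding z_def using p(1)[OF that] by (intro L_tensor_R0 gr_scale proj_mem)
  have unit: "tpow (b l) c * inverse (tpow (b l) c) = 1" if "l < r" for l c
    using b[OF that] by (intro right_inverse tpow_nonzero)
  have eval_z: "eval_at sc (b l) (z j c) = (if j = l then proj c (y l) else 0)" if "j < r" "l < r" for j l c
    using p(2)[OF that] b[OF that(2)] unit[OF that(2)]
    by (auto simp: z_def eval_tensor laurent_eval_mult)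
  let ?x = "\<Sum>j<r. \<Sum>c\<in>Gset m. z j c"
  have "eval_at sc (b l) ?x = y l" if l: "l < r" for l
  proof -
    have "eval_at sc (b l) ?x = (\<Sum>j<r. eval_at sc (b l) (\<Sum>c\<in>Gset m. z j c))"
      using zL by (intro eval_sum L_sum) auto
    also have "\<dots> = (\<Sum>j<r. \<Sum>c\<in>Gset m. eval_at sc (b l) (z j c))"
      using zL by (intro sum.cong refl eval_sum) auto
    also have "\<dots> = (\<Sum>j<r. if j = l then y l else 0)"
      using l by (intro sum.cong) (auto simp: eval_z sum_proj)
    finally show ?thesis
      using l by simp
  qed
  moreover have "?x \<in> L"
    using zL by (intro L_sum) auto
  ultimately show ?thesis
    by blast
qed

end

text \<open>The isomorphism is expressed without a quotient type: vanishing on the kernel makes the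
  induced map well defined, the next three clauses make it a Lie homomorphism, and the last two give
  injectivity and surjectivity. Tuples in the r-fold sum are functions on \<open>nat\<close> read at
  j < r.\<close>

theorem theorem4p2:
  fixes sc :: "'f::field_char_0 \<Rightarrow> 'g::ab_group_add \<Rightarrow> 'g"
    and br :: "'g \<Rightarrow> 'g \<Rightarrow> 'g"
    and \<sigma> :: "'n::finite \<Rightarrow> 'g \<Rightarrow> 'g"
    and m :: "'n \<Rightarrow> nat"
    and \<xi> :: "'n \<Rightarrow> 'f"
    and B :: "('n \<Rightarrow> int) \<Rightarrow> 'g set"
    and scV :: "'f \<Rightarrow> 'v::ab_group_add \<Rightarrow> 'v"
    and \<phi> :: "(('n \<Rightarrow> int) \<Rightarrow> 'g) \<Rightarrow> 'v \<Rightarrow> 'v"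
    and r :: nat
    and a :: "nat \<Rightarrow> 'n \<Rightarrow> 'f"
    and b :: "nat \<Rightarrow> 'n \<Rightarrow> 'f"
  assumes F_closed: "alg_closed TYPE('f)"
    and g_simple: "simple_lie_algebra sc br"
    and g_fin: "fin_dim sc"
    and \<sigma>_aut: "\<And>i. lie_automorphism sc br (\<sigma> i)"
    and \<sigma>_order: "\<And>i. has_order (\<sigma> i) (m i)"
    and \<sigma>_comm: "\<And>i j. \<sigma> i \<circ> \<sigma> j = \<sigma> j \<circ> \<sigma> i"
    and \<xi>_prim: "\<And>i. primitive_root (\<xi> i) (m i)"
    and B_basis: "\<And>c. c \<in> Gset m \<Longrightarrow> module.independent sc (B c)
                        \<and> module.span sc (B c) = grade_space sc \<sigma> \<xi> c"
    and \<phi>_rep: "representation_of sc br \<sigma> \<xi> scV \<phi>"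
    and V_fin: "fin_dim scV"
    and \<phi>_irr: "irreducible_rep sc \<sigma> \<xi> scV \<phi>"
    and a_nonzero: "\<And>j i. j < r \<Longrightarrow> a j i \<noteq> 0"
    and a_distinct: "\<And>j l. j < r \<Longrightarrow> l < r \<Longrightarrow> a j = a l \<Longrightarrow> j = l"
    and a_points: "ideal_I sc m B (rep_kernel sc \<sigma> \<xi> \<phi>) \<inter> R0 m
                     = R0 m \<inter> (\<Inter>j\<in>{..<r}. M_ideal m (a j))"
    and b_nonzero: "\<And>j i. j < r \<Longrightarrow> b j i \<noteq> 0"
    and b_roots: "\<And>j i. j < r \<Longrightarrow> b j i ^ m i = a j i"
  shows "(\<forall>x\<in>rep_kernel sc \<sigma> \<xi> \<phi>. \<forall>j<r. eval_at sc (b j) x = 0)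
    \<and> (\<forall>x\<in>multiloop sc \<sigma> \<xi>. \<forall>y\<in>multiloop sc \<sigma> \<xi>. \<forall>j<r.
          eval_at sc (b j) (Ladd x y) = eval_at sc (b j) x + eval_at sc (b j) y)
    \<and> (\<forall>x\<in>multiloop sc \<sigma> \<xi>. \<forall>c. \<forall>j<r.
          eval_at sc (b j) (Lscale sc c x) = sc c (eval_at sc (b j) x))
    \<and> (\<forall>x\<in>multiloop sc \<sigma> \<xi>. \<forall>y\<in>multiloop sc \<sigma> \<xi>. \<forall>j<r.
          eval_at sc (b j) (Lbr br x y) = br (eval_at sc (b j) x) (eval_at sc (b j) y))
    \<and> (\<forall>x\<in>multiloop sc \<sigma> \<xi>. (\<forall>j<r. eval_at sc (b j) x = 0) \<longrightarrow> x \<in> rep_kernel sc \<sigma> \<xi> \<phi>)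
    \<and> (\<forall>y :: nat \<Rightarrow> 'g. \<exists>x\<in>multiloop sc \<sigma> \<xi>. \<forall>j<r. eval_at sc (b j) x = y j)"
proof -
  interpret multiloop_bases sc br \<sigma> m \<xi> B
  proof (intro multiloop_bases.intro multiloop_setup.intro simple_lie.intro)
    show "vector_space sc"
      using g_simple by (simp add: simple_lie_algebra_def lie_algebra_def)
    show "simple_lie_axioms sc br"
      using F_closed g_simple g_fin by (simp add: simple_lie_axioms_def)
    show "multiloop_setup_axioms sc br \<sigma> m \<xi>"
      using \<sigma>_aut \<sigma>_order \<sigma>_comm \<xi>_prim by (simp add: multiloop_setup_axioms_def)
    show "multiloop_bases_axioms sc \<sigma> m \<xi> B"
      using B_basis by (simp add: multiloop_bases_axioms_def)
  qed
  have K: "loop_ideal (rep_kernel sc \<sigma> \<xi> \<phi>)"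
    using \<phi>_rep by (rule loop_ideal_rep_kernel)
  \<comment> \<open>Vanishing on the kernel takes from \<open>a_points\<close> the inclusion into
    each M_(a_j); injectivity below takes the reverse inclusion.\<close>
  have "eval_at sc (b j) x = 0" if "x \<in> rep_kernel sc \<sigma> \<xi> \<phi>" "j < r" for x j
    using a_points b_nonzero b_roots that by (intro ideal_eval_zero[OF K, of "b j" "a j"]) auto
  moreover have "eval_at sc (b j) (Ladd x y) = eval_at sc (b j) x + eval_at sc (b j) y"
    if "x \<in> L" "y \<in> L" for x y j
    using eval_add[OF that] by (simp add: Ladd_def plus_fun_def)
  moreover have "x \<in> rep_kernel sc \<sigma> \<xi> \<phi>" if "x \<in> L" "\<forall>j<r. eval_at sc (b j) x = 0" for x
    using a_points b_nonzero b_roots that by (intro eval_zero_imp_mem[OF K, of r b a]) auto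
  moreover have "\<exists>x\<in>L. \<forall>j<r. eval_at sc (b j) x = y j" for y
    using b_nonzero b_roots a_distinct by (rule eval_surjective)
  ultimately show ?thesis
    using b_nonzero by (simp add: eval_scale eval_Lbr)
qed

end
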